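(* Let $0<p\leq1$, let $\phi:\mathbb{R}^m\to\mathbb{R}^l$ be a feature map, let $\bm{X}=[\bm{x}_1,\ldots,\bm{x}_n]\in\mathbb{R}^{m\times n}$ be arbitrary, and let $\mathcal{K}(\bm{X})=\phi(\bm{X})^T\phi(\bm{X})$. Let $0\leq w_1\leq w_2\leq\cdots\leq w_n$ be weights and $\bm{W}=\textup{diag}(w_1,\ldots,w_n)$. Then $$\sum_{i=1}^nw_i\sigma_i^p(\phi(\bm{X}))=\min_{\bm{Q}\in\mathbb{R}^{n\times n},\ \bm{Q}^T\bm{Q}=\bm{Q}\bm{Q}^T=\bm{I}_n}\textup{Tr}\Big(\big(\bm{W}^{1/p}\bm{Q}^T\mathcal{K}(\bm{X})\bm{Q}\bm{W}^{1/p}\big)^{p/2}\Big).$$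
   Context: $\phi(\bm{X})=[\phi(\bm{x}_1),\ldots,\phi(\bm{x}_n)]\in\mathbb{R}^{l\times n}$ and $[\mathcal{K}(\bm{X})]_{ij}=\phi(\bm{x}_i)^T\phi(\bm{x}_j)$. $\sigma_1(\bm{Y})\geq\cdots\geq\sigma_n(\bm{Y})\geq0$ denote the singular values of an $l\times n$ matrix $\bm{Y}$ in decreasing order (padded with zeros if $l<n$). For a positive semidefinite matrix $\bm{A}$, $\bm{A}^{p/2}$ is its principal matrix power. $\bm{I}_n$ is the $n\times n$ identity. *)

theory Defs
  imports "Jordan_Normal_Form.Char_Poly"
begin

definition mtrace :: "'a::comm_ring_1 mat \<Rightarrow> 'a" where
  "mtrace A = (\<Sum>i<dim_row A. A $$ (i,i))"

definition orth_mat :: "nat \<Rightarrow> real mat \<Rightarrow> bool" where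
  "orth_mat n Q \<longleftrightarrow> Q \<in> carrier_mat n n \<and>
     transpose_mat Q * Q = 1\<^sub>m n \<and> Q * transpose_mat Q = 1\<^sub>m n"

text \<open>Principal power A^r of a real symmetric positive semidefinite matrix,
  via an orthogonal diagonalisation A = U diag(d) U^T with d \<ge> 0:
  A^r = U diag(d^r) U^T (independent of the choice of U for PSD A).\<close>
definition psd_power :: "real mat \<Rightarrow> real \<Rightarrow> real mat" where
  "psd_power A r = (SOME B. \<exists>U d. orth_mat (dim_row A) U \<and>
      (\<forall>i<dim_row A. 0 \<le> d i) \<and>
      A = U * mat_diag (dim_row A) d * transpose_mat U \<and>
      B = U * mat_diag (dim_row A) (\<lambda>i. d i powr r) * transpose_mat U)"

definition gram_eigs_desc :: "real mat \<Rightarrow> real list" where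
  "gram_eigs_desc Y =
     rev (sorted_list_of_multiset (proots (char_poly (transpose_mat Y * Y))))"

text \<open>i-th singular value (1-based, i = 1..dim_col Y) of an l x n matrix Y:
  sigma_i(Y) = sqrt(lambda_i(Y^T Y)); this gives n values, padded with zeros if l < n.\<close>
definition singular_value :: "real mat \<Rightarrow> nat \<Rightarrow> real" where
  "singular_value Y i = sqrt (gram_eigs_desc Y ! (i - 1))"

definition feat_mat :: "nat \<Rightarrow> (real vec \<Rightarrow> real vec) \<Rightarrow> real mat \<Rightarrow> real mat" where
  "feat_mat l \<phi> X = mat_of_cols l (map (\<lambda>j. \<phi> (col X j)) [0..<dim_col X])"

end

theory Submission
  imports Defs "HOL-Analysis.Convex"
begin

text \<open>
  Write \<open>s = p/2\<close>, \<open>D = W\<^bsup>1/p\<^esup>\<close>, \<open>B = Q\<^sup>T K Q\<close> and \<open>F(Q) = Tr((D B D)\<^sup>s)\<close>. By compactness \<open>F\<close> attains its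
  minimum over the orthogonal group, say at \<open>R\<close> with \<open>M = D B D\<close>. Assume first that \<open>K\<close> is
  positive definite and the weights are positive and distinct. Since \<open>x\<^sup>s\<close> is concave,
  \<open>F(Q) \<le> s Tr(M\<^bsup>s-1\<^esup> D Q\<^sup>T K Q D) + (1 - s) F(R)\<close> with equality at \<open>Q = R\<close>, so \<open>R\<close> also minimises
  the linear functional \<open>Tr(C Q\<^sup>T K Q)\<close> with \<open>C = D M\<^bsup>s-1\<^esup> D\<close>. Differentiating along plane
  rotations gives \<open>C B = B C\<close>, which amounts to \<open>D\<^sup>2 M\<^sup>s = M\<^sup>s D\<^sup>2\<close>; hence \<open>M\<^sup>s\<close>, \<open>M\<close> and \<open>B\<close> are
  diagonal, and comparing with transposed entries shows that the diagonal of \<open>B\<close> is the decreasing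
  list of eigenvalues of \<open>K\<close>. The general case follows by perturbing \<open>W\<close> and \<open>K\<close>.

  The spectral theorem is obtained from the same stationarity argument, applied to a minimiser
  of \<open>Tr(N Q\<^sup>T A Q)\<close> with \<open>N = diag(0, \<dots>, n - 1)\<close>.
\<close>

subsection \<open>Trace and orthogonal matrices\<close>

lemma index_mult_mat_sum:
  assumes "A \<in> carrier_mat n k" "B \<in> carrier_mat k m" "i < n" "j < m"
  shows "(A * B) $$ (i,j) = (\<Sum>x<k. A $$ (i,x) * B $$ (x,j))"
  using assms by (simp add: scalar_prod_def atLeast0LessThan)

lemma mat_diag_index [simp]:
  "i < n \<Longrightarrow> j < n \<Longrightarrow> mat_diag n f $$ (i,j) = (if i = j then f i else 0)"
  by (auto simp: mat_diag_def)

lemma mat_diag_cong: "(\<And>i. i < n \<Longrightarrow> f i = g i) \<Longrightarrow> mat_diag n f = mat_diag n g"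
  by (rule eq_matI) (auto simp: mat_diag_def)

lemma transpose_mat_diag [simp]: "transpose_mat (mat_diag n f) = mat_diag n f"
  by (rule eq_matI) (auto simp: mat_diag_def)

lemma mtrace_carrier: "A \<in> carrier_mat n n \<Longrightarrow> mtrace A = (\<Sum>i<n. A $$ (i,i))"
  by (simp add: mtrace_def)

lemma mtrace_mat_diag: "mtrace (mat_diag n f) = (\<Sum>i<n. f i)"
  by (simp add: mtrace_carrier[OF mat_diag_dim])

lemma mtrace_mult:
  assumes "A \<in> carrier_mat n k" "B \<in> carrier_mat k n"
  shows "mtrace (A * B) = (\<Sum>i<n. \<Sum>j<k. A $$ (i,j) * B $$ (j,i))"
  using assms by (auto simp: mtrace_def index_mult_mat_sum simp del: index_mult_mat(1) intro!: sum.cong)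

lemma mtrace_mult_commute:
  fixes A B :: "'a::comm_ring_1 mat"
  assumes "A \<in> carrier_mat n k" "B \<in> carrier_mat k n"
  shows "mtrace (A * B) = mtrace (B * A)"
  unfolding mtrace_mult[OF assms] mtrace_mult[OF assms(2,1)]
  by (subst sum.swap) (simp add: mult.commute)

lemma orth_matD:
  assumes "orth_mat n Q"
  shows "Q \<in> carrier_mat n n" "transpose_mat Q \<in> carrier_mat n n"
    "transpose_mat Q * Q = 1\<^sub>m n" "Q * transpose_mat Q = 1\<^sub>m n"
  using assms by (auto simp: orth_mat_def)

lemma orth_mat_cancel:
  assumes Q: "orth_mat n Q" and A: "A \<in> carrier_mat n k"
  shows "transpose_mat Q * (Q * A) = A" "Q * (transpose_mat Q * A) = A"
  using orth_matD[OF Q] A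
  by (simp_all add: assoc_mult_mat[of _ n n _ n _ k, symmetric] del: assoc_mult_mat)

lemma orth_mat_transpose: "orth_mat n Q \<Longrightarrow> orth_mat n (transpose_mat Q)"
  by (auto simp: orth_mat_def)

lemma orth_mat_mult:
  assumes P: "orth_mat n P" and Q: "orth_mat n Q"
  shows "orth_mat n (P * Q)"
proof -
  note [simp] = orth_matD[OF P] orth_matD[OF Q] orth_mat_cancel[OF P, of _ n] orth_mat_cancel[OF Q, of _ n]
    assoc_mult_mat[of _ n n _ n _ n] mult_carrier_mat[of _ n n _ n] transpose_mult[of _ n n _ n]
  show ?thesis by (auto simp: orth_mat_def)
qed

lemma orth_mat_one: "orth_mat n (1\<^sub>m n)"
  by (simp add: orth_mat_def)

lemma orth_mat_col_norm:
  assumes Q: "orth_mat n Q" and j: "j < n"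
  shows "(\<Sum>i<n. (Q $$ (i,j))\<^sup>2) = 1"
proof -
  have "(transpose_mat Q * Q) $$ (j,j) = 1"
    using j orth_matD[OF Q] by simp
  thus ?thesis using orth_matD[OF Q] j
    by (subst (asm) index_mult_mat_sum[of _ n n _ n]) (auto simp: power2_eq_square)
qed

lemma orth_mat_row_norm:
  assumes Q: "orth_mat n Q" and i: "i < n"
  shows "(\<Sum>j<n. (Q $$ (i,j))\<^sup>2) = 1"
  using orth_mat_col_norm[OF orth_mat_transpose[OF Q] i] orth_matD(1)[OF Q] i by simp

lemma orth_mat_entry_bound:
  assumes Q: "orth_mat n Q" and ij: "i < n" "j < n"
  shows "\<bar>Q $$ (i,j)\<bar> \<le> 1"
proof -
  have "(Q $$ (i,j))\<^sup>2 \<le> (\<Sum>i<n. (Q $$ (i,j))\<^sup>2)"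
    using ij by (intro member_le_sum) auto
  thus ?thesis using orth_mat_col_norm[OF Q ij(2)] by (simp add: abs_square_le_1)
qed

subsection \<open>Compactness of the orthogonal group\<close>

text \<open>Bolzano-Weierstrass for finitely many coordinates: each new index passes to a further
  monotone subsequence, along which the earlier coordinates still converge.\<close>

lemma bounded_family_convergent_subseq:
  fixes X :: "nat \<Rightarrow> 'i \<Rightarrow> real"
  assumes "finite I" "\<And>k i. i \<in> I \<Longrightarrow> \<bar>X k i\<bar> \<le> c"
  shows "\<exists>f::nat \<Rightarrow> nat. strict_mono f \<and> (\<forall>i\<in>I. convergent (\<lambda>k. X (f k) i))"
  using assms
proof (induction I rule: finite_induct)
  case empty
  show ?case by (auto intro!: exI[of _ id] simp: strict_mono_def)
next
  case (insert a I)
  then obtain f :: "nat \<Rightarrow> nat" where f: "strict_mono f" "\<forall>i\<in>I. convergent (\<lambda>k. X (f k) i)"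
    by auto
  obtain g :: "nat \<Rightarrow> nat" where g: "strict_mono g" "monoseq (\<lambda>k. X (f (g k)) a)"
    using seq_monosub[of "\<lambda>k. X (f k) a"] by auto
  have "Bseq (\<lambda>k. X (f (g k)) a)"
    using insert.prems by (intro BseqI'[of _ c]) auto
  then have "convergent (\<lambda>k. X (f (g k)) a)"
    using g by (intro Bseq_monoseq_convergent)
  moreover have "convergent (\<lambda>k. X (f (g k)) i)" if "i \<in> I" for i
    using convergent_subseq_convergent[OF _ g(1), of "\<lambda>k. X (f k) i"] f(2) that
    by (auto simp: o_def)
  ultimately show ?case
    using strict_mono_o[OF f(1) g(1)] by (intro exI[of _ "f \<circ> g"]) (auto simp: o_def)
qed

text \<open>Entrywise convergence at a fixed dimension. The carrier conditions make the limit unique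
  as a matrix and let products be expanded entry by entry.\<close>

definition mat_tendsto :: "nat \<Rightarrow> (nat \<Rightarrow> real mat) \<Rightarrow> real mat \<Rightarrow> bool" where
  "mat_tendsto n M L \<longleftrightarrow> (\<forall>k. M k \<in> carrier_mat n n) \<and> L \<in> carrier_mat n n \<and>
     (\<forall>i<n. \<forall>j<n. (\<lambda>k. M k $$ (i,j)) \<longlonglongrightarrow> L $$ (i,j))"

lemma mat_tendsto_const: "A \<in> carrier_mat n n \<Longrightarrow> mat_tendsto n (\<lambda>_. A) A"
  by (simp add: mat_tendsto_def)

lemma mat_tendsto_transpose:
  "mat_tendsto n M L \<Longrightarrow> mat_tendsto n (\<lambda>k. transpose_mat (M k)) (transpose_mat L)"
proof -
  assume M: "mat_tendsto n M L"
  then have c: "M k \<in> carrier_mat n n" "L \<in> carrier_mat n n" for k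
    by (auto simp: mat_tendsto_def)
  have "(\<lambda>k. transpose_mat (M k) $$ (i,j)) \<longlonglongrightarrow> transpose_mat L $$ (i,j)" if "i < n" "j < n" for i j
  proof -
    have "transpose_mat (M k) $$ (i,j) = M k $$ (j,i)" for k
      using c(1)[of k] that by simp
    thus ?thesis using M c(2) that by (simp add: mat_tendsto_def)
  qed
  thus ?thesis using c by (simp add: mat_tendsto_def)
qed

lemma mat_tendsto_mult:
  assumes M: "mat_tendsto n M L" and N: "mat_tendsto n N R"
  shows "mat_tendsto n (\<lambda>k. M k * N k) (L * R)"
proof -
  have c: "M k \<in> carrier_mat n n" "N k \<in> carrier_mat n n" "L \<in> carrier_mat n n" "R \<in> carrier_mat n n" for k
    using assms by (auto simp: mat_tendsto_def)
  have "(\<lambda>k. (M k * N k) $$ (i,j)) \<longlonglongrightarrow> (L * R) $$ (i,j)" if "i < n" "j < n" for i j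
    unfolding index_mult_mat_sum[OF c(1,2) that] index_mult_mat_sum[OF c(3,4) that]
    using assms that by (intro tendsto_sum tendsto_mult) (auto simp: mat_tendsto_def)
  thus ?thesis using c by (simp add: mat_tendsto_def mult_carrier_mat[of _ n n])
qed

lemma mat_tendsto_diag:
  "(\<And>i. i < n \<Longrightarrow> (\<lambda>k. d k i) \<longlonglongrightarrow> e i) \<Longrightarrow>
    mat_tendsto n (\<lambda>k. mat_diag n (d k)) (mat_diag n e)"
  by (auto simp: mat_tendsto_def)

lemma mat_tendsto_subseq:
  "mat_tendsto n M L \<Longrightarrow> strict_mono f \<Longrightarrow> mat_tendsto n (\<lambda>k. M (f k)) L"
  unfolding mat_tendsto_def
proof (intro conjI allI impI)
  fix i j
  assume *: "(\<forall>k. M k \<in> carrier_mat n n) \<and> L \<in> carrier_mat n n \<and>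
     (\<forall>i<n. \<forall>j<n. (\<lambda>k. M k $$ (i,j)) \<longlonglongrightarrow> L $$ (i,j))" and f: "strict_mono f" and ij: "i < n" "j < n"
  have "(\<lambda>k. M k $$ (i,j)) \<longlonglongrightarrow> L $$ (i,j)" using * ij by simp
  from LIMSEQ_subseq_LIMSEQ[OF this f] show "(\<lambda>k. M (f k) $$ (i,j)) \<longlonglongrightarrow> L $$ (i,j)"
    by (simp add: o_def)
qed auto

lemma mat_tendsto_unique:
  assumes "mat_tendsto n M L" "mat_tendsto n M R"
  shows "L = R"
proof (rule eq_matI)
  fix i j assume "i < dim_row R" "j < dim_col R"
  thus "L $$ (i,j) = R $$ (i,j)"
    using assms LIMSEQ_unique[of "\<lambda>k. M k $$ (i,j)" "L $$ (i,j)" "R $$ (i,j)"]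
    by (auto simp: mat_tendsto_def)
qed (use assms in \<open>auto simp: mat_tendsto_def\<close>)

lemma mat_tendsto_mtrace:
  assumes "mat_tendsto n M L"
  shows "(\<lambda>k. mtrace (M k)) \<longlonglongrightarrow> mtrace L"
proof -
  have "mtrace (M k) = (\<Sum>i<n. M k $$ (i,i))" "mtrace L = (\<Sum>i<n. L $$ (i,i))" for k
    using assms by (auto simp: mat_tendsto_def mtrace_carrier)
  thus ?thesis using assms by (auto simp: mat_tendsto_def intro!: tendsto_sum)
qed

text \<open>The entries are bounded by 1, and both equations defining \<open>orth_mat\<close>
  survive entrywise limits, so the group is sequentially compact.\<close>

lemma orth_mat_convergent_subseq:
  assumes Q: "\<And>k. orth_mat n (Q k)"
  obtains f R where "strict_mono (f::nat \<Rightarrow> nat)" "orth_mat n R" "mat_tendsto n (\<lambda>k. Q (f k)) R"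
proof -
  obtain f :: "nat \<Rightarrow> nat" where f: "strict_mono f"
    "\<forall>ij\<in>{..<n}\<times>{..<n}. convergent (\<lambda>k. Q (f k) $$ ij)"
    using bounded_family_convergent_subseq[of "{..<n}\<times>{..<n}" "\<lambda>k ij. Q k $$ ij" 1]
      orth_mat_entry_bound[OF Q] by auto
  define R where "R = mat n n (\<lambda>ij. lim (\<lambda>k. Q (f k) $$ ij))"
  have lim: "mat_tendsto n (\<lambda>k. Q (f k)) R"
    using f(2) orth_matD[OF Q] by (auto simp: mat_tendsto_def R_def convergent_LIMSEQ_iff)
  have "mat_tendsto n (\<lambda>k. 1\<^sub>m n) (transpose_mat R * R)"
    using mat_tendsto_mult[OF mat_tendsto_transpose[OF lim] lim] orth_matD[OF Q] by simp
  from mat_tendsto_unique[OF this mat_tendsto_const[OF one_carrier_mat]]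
  have 1: "transpose_mat R * R = 1\<^sub>m n" .
  have "mat_tendsto n (\<lambda>k. 1\<^sub>m n) (R * transpose_mat R)"
    using mat_tendsto_mult[OF lim mat_tendsto_transpose[OF lim]] orth_matD[OF Q] by simp
  from mat_tendsto_unique[OF this mat_tendsto_const[OF one_carrier_mat]]
  have "R * transpose_mat R = 1\<^sub>m n" .
  with 1 lim have "orth_mat n R"
    by (simp add: orth_mat_def mat_tendsto_def)
  thus ?thesis using that f lim by blast
qed

text \<open>Continuity of \<open>F\<close> is demanded only along a subsequence, because for traces
  of powers it is derived by extracting convergent diagonalising matrices.\<close>

lemma orth_mat_minimizer:
  fixes F :: "real mat \<Rightarrow> real"
  assumes F: "\<And>Q R. (\<And>k. orth_mat n (Q k)) \<Longrightarrow> orth_mat n R \<Longrightarrow> mat_tendsto n Q R \<Longrightarrow>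
      \<exists>f::nat \<Rightarrow> nat. strict_mono f \<and> (\<lambda>k. F (Q (f k))) \<longlonglongrightarrow> F R"
  obtains R where "orth_mat n R" "\<And>Q. orth_mat n Q \<Longrightarrow> F R \<le> F Q"
proof -
  have sub: "\<exists>f R. strict_mono (f::nat \<Rightarrow> nat) \<and> orth_mat n R \<and> (\<lambda>k. F (Q (f k))) \<longlonglongrightarrow> F R"
    if Q: "\<And>k. orth_mat n (Q k)" for Q
  proof -
    obtain f R where f: "strict_mono (f::nat \<Rightarrow> nat)" "orth_mat n R" "mat_tendsto n (\<lambda>k. Q (f k)) R"
      using orth_mat_convergent_subseq[of n Q] Q by blast
    then obtain g :: "nat \<Rightarrow> nat" where "strict_mono g" "(\<lambda>k. F (Q (f (g k)))) \<longlonglongrightarrow> F R"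
      using F[of "\<lambda>k. Q (f k)" R] Q by auto
    thus ?thesis using strict_mono_o[OF f(1)] f(2) by (intro exI[of _ "f \<circ> g"] exI[of _ R]) (auto simp: o_def)
  qed
  \<comment> \<open>Were \<open>F\<close> unbounded below, values under \<open>-k\<close> at
    \<open>Q k\<close> would persist along a subsequence on which \<open>F\<close> tends to the
    finite value \<open>F R\<close>.\<close>
  have bdd: "bdd_below (F ` Collect (orth_mat n))"
  proof (rule ccontr)
    assume "\<not> ?thesis"
    then have "\<exists>Q. orth_mat n Q \<and> F Q < - real k" for k
      by (auto simp: bdd_below_def not_le)
    then obtain Q where Q: "\<And>k. orth_mat n (Q k)" "\<And>k. F (Q k) < - real k" by metis
    then obtain f R where f: "strict_mono (f::nat \<Rightarrow> nat)" "(\<lambda>k. F (Q (f k))) \<longlonglongrightarrow> F R"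
      using sub by blast
    have "F (Q (f k)) \<le> - real k" for k
      using Q(2)[of "f k"] seq_suble[OF f(1), of k] by linarith
    then have "F R \<le> - real k" for k
      by (intro LIMSEQ_le_const2[OF f(2)] exI[of _ k]) (meson le_minus_iff of_nat_mono order_trans neg_le_iff_le)
    then have "F R \<le> - real (Suc (nat \<lceil>\<bar>F R\<bar>\<rceil>))" .
    thus False by linarith
  qed
  let ?m = "INF Q\<in>Collect (orth_mat n). F Q"
  \<comment> \<open>A minimising sequence, within \<open>1/(k+1)\<close> of the infimum; its
    subsequential limit attains it.\<close>
  have "\<exists>Q. orth_mat n Q \<and> F Q < ?m + inverse (real (Suc k))" for k
    using cINF_less_iff[OF _ bdd, of "?m + inverse (real (Suc k))"] orth_mat_one by auto
  then obtain Q where Q: "\<And>k. orth_mat n (Q k)" "\<And>k. F (Q k) < ?m + inverse (real (Suc k))" by metis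
  obtain f R where f: "strict_mono (f::nat \<Rightarrow> nat)" "orth_mat n R" "(\<lambda>k. F (Q (f k))) \<longlonglongrightarrow> F R"
    using sub[of Q] Q(1) by blast
  have "(\<lambda>k. ?m + inverse (real (Suc (f k)))) \<longlonglongrightarrow> ?m + 0"
    using LIMSEQ_subseq_LIMSEQ[OF LIMSEQ_inverse_real_of_nat f(1)]
    by (intro tendsto_intros) (simp add: o_def)
  then have "F R \<le> ?m + 0"
    using Q(2) by (intro LIMSEQ_le[OF f(3)]) (auto intro: less_imp_le)
  then have "F R \<le> F Q" if "orth_mat n Q" for Q
    using cINF_lower[OF bdd, of Q] that by auto
  thus ?thesis using f(2) that by blast
qed

subsection \<open>Stationarity and the spectral theorem\<close>

text \<open>A Givens rotation, given column by column. For \<open>i \<noteq> j\<close> it is the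
  identity at \<open>t = 0\<close>, with derivative there the skew matrix that has 1 at
  \<open>(i,j)\<close> and -1 at \<open>(j,i)\<close>.\<close>

definition plane_rotation :: "nat \<Rightarrow> nat \<Rightarrow> nat \<Rightarrow> real \<Rightarrow> real mat" where
  "plane_rotation n i j t = mat n n (\<lambda>(a,b).
     if b = i then cos t * of_bool (a = i) - sin t * of_bool (a = j)
     else if b = j then sin t * of_bool (a = i) + cos t * of_bool (a = j)
     else of_bool (a = b))"

lemma plane_rotation_carrier: "plane_rotation n i j t \<in> carrier_mat n n"
  by (simp add: plane_rotation_def)

lemma sum_of_bool_mult:
  fixes f :: "nat \<Rightarrow> 'a::semiring_1"
  assumes "i < n"
  shows "(\<Sum>a<n. of_bool (a = i) * f a) = f i" "(\<Sum>a<n. f a * of_bool (a = i)) = f i"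
    "(\<Sum>a<n. of_bool (i = a) * f a) = f i" "(\<Sum>a<n. f a * of_bool (i = a)) = f i"
  using assms by (simp_all add: of_bool_def if_distrib if_distribR cong: if_cong)

lemma orth_mat_plane_rotation:
  assumes ij: "i < n" "j < n" "i \<noteq> j"
  shows "orth_mat n (plane_rotation n i j t)"
proof -
  let ?G = "plane_rotation n i j t"
  have c: "?G \<in> carrier_mat n n" "transpose_mat ?G \<in> carrier_mat n n"
    using plane_rotation_carrier by auto
  have "(transpose_mat ?G * ?G) $$ (a,b) = 1\<^sub>m n $$ (a,b)" if ab: "a < n" "b < n" for a b
  proof -
    \<comment> \<open>Pairing column \<open>a\<close> with an arbitrary \<open>g\<close> leaves at
      most two terms; taking column \<open>b\<close> for \<open>g\<close> gives the inner products
      of columns.\<close>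
    have col: "(\<Sum>x<n. ?G $$ (x,a) * g x) =
        (if a = i then cos t * g i - sin t * g j else if a = j then sin t * g i + cos t * g j else g a)" for g
    proof -
      have "(\<Sum>x<n. ?G $$ (x,a) * g x) = (\<Sum>x<n. if a = i
          then cos t * (of_bool (x = i) * g x) - sin t * (of_bool (x = j) * g x)
          else if a = j then sin t * (of_bool (x = i) * g x) + cos t * (of_bool (x = j) * g x)
          else of_bool (x = a) * g x)"
        using ab by (intro sum.cong refl) (auto simp: plane_rotation_def algebra_simps)
      also have "\<dots> = (if a = i then cos t * g i - sin t * g j
          else if a = j then sin t * g i + cos t * g j else g a)"
        by (cases "a = i"; cases "a = j")
          (simp_all only: simp_thms if_True if_False sum.distrib sum_subtractf sum_distrib_left[symmetric]
            sum_of_bool_mult[OF ij(1)] sum_of_bool_mult[OF ij(2)] sum_of_bool_mult[OF ab(1)])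
      finally show ?thesis .
    qed
    have "(transpose_mat ?G * ?G) $$ (a,b) = (\<Sum>x<n. ?G $$ (x,a) * ?G $$ (x,b))"
      using c ab by (subst index_mult_mat_sum[OF c(2,1)]) (auto intro!: sum.cong)
    also have "\<dots> = of_bool (a = b)"
      unfolding col using ab ij sin_cos_squared_add[of t]
      by (auto simp: plane_rotation_def power2_eq_square algebra_simps)
    finally show ?thesis using ab by simp
  qed
  then have "transpose_mat ?G * ?G = 1\<^sub>m n"
    using c by (intro eq_matI) auto
  thus ?thesis
    using c mat_mult_left_right_inverse[OF c(2,1)] by (simp add: orth_mat_def)
qed

text \<open>Writes the trace as a polynomial in the entries of \<open>G\<close>, which can be
  differentiated term by term.\<close>

lemma mtrace_conj_expand:
  assumes c: "C \<in> carrier_mat n n" "G \<in> carrier_mat n n" "B \<in> carrier_mat n n"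
  shows "mtrace (C * (transpose_mat G * B * G)) =
    (\<Sum>a<n. \<Sum>b<n. \<Sum>x<n. \<Sum>y<n. C $$ (a,b) * G $$ (x,b) * B $$ (x,y) * G $$ (y,a))"
proof -
  have t: "transpose_mat G \<in> carrier_mat n n" "transpose_mat G * B \<in> carrier_mat n n"
    "transpose_mat G * B * G \<in> carrier_mat n n" using c by auto
  have "(transpose_mat G * B * G) $$ (b,a) = (\<Sum>x<n. \<Sum>y<n. G $$ (x,b) * B $$ (x,y) * G $$ (y,a))"
    if "a < n" "b < n" for a b
    unfolding index_mult_mat_sum[OF t(2) c(2) that(2,1)]
    using that c by (subst sum.swap) (auto intro!: sum.cong
        simp: index_mult_mat_sum[OF t(1) c(3)] sum_distrib_right simp del: index_mult_mat(1))
  thus ?thesis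
    unfolding mtrace_mult[OF c(1) t(3)] by (auto intro!: sum.cong simp: sum_distrib_left mult.assoc)
qed

text \<open>Along the rotation in the plane of \<open>i\<close> and \<open>j\<close> the derivative
  at 0 is twice the \<open>(i,j)\<close> entry of \<open>B * C - C * B\<close>, and it vanishes at a
  minimum. The diagonal of the commutator vanishes by symmetry.\<close>

lemma mtrace_conj_stationary_one:
  fixes C B :: "real mat"
  assumes C: "C \<in> carrier_mat n n" "transpose_mat C = C"
    and B: "B \<in> carrier_mat n n" "transpose_mat B = B"
    and min: "\<And>G. orth_mat n G \<Longrightarrow> mtrace (C * B) \<le> mtrace (C * (transpose_mat G * B * G))"
  shows "C * B = B * C"
proof (rule eq_matI)
  fix i j assume "i < dim_row (B * C)" "j < dim_col (B * C)"
  then have ij: "i < n" "j < n" using B C by auto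
  have symC: "C $$ (a,b) = C $$ (b,a)" if "a < n" "b < n" for a b
    using C that by (metis index_transpose_mat(1) carrier_matD)
  have symB: "B $$ (a,b) = B $$ (b,a)" if "a < n" "b < n" for a b
    using B that by (metis index_transpose_mat(1) carrier_matD)
  show "(C * B) $$ (i,j) = (B * C) $$ (i,j)"
  proof (cases "i = j")
    case True
    show ?thesis
      unfolding index_mult_mat_sum[OF C(1) B(1) ij] index_mult_mat_sum[OF B(1) C(1) ij] 
      using True ij by (auto intro!: sum.cong simp: symC[of j] symB[of j])
  next
    case False
    define E where "E = (\<lambda>x y::nat. of_bool (x = i) * of_bool (y = j) - of_bool (x = j) * of_bool (y = i) :: real)"
    define f where "f = (\<lambda>t. mtrace (C * (transpose_mat (plane_rotation n i j t) * B * plane_rotation n i j t)))"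
    let ?G = "plane_rotation n i j"
    have G0: "?G 0 $$ (x,y) = of_bool (x = y)" if "x < n" "y < n" for x y
      using that by (auto simp: plane_rotation_def)
    have dG: "((\<lambda>t. ?G t $$ (x,y)) has_real_derivative E x y) (at 0)" if "x < n" "y < n" for x y
      using that False unfolding plane_rotation_def E_def
      by (cases "y = i"; cases "y = j") (auto intro!: derivative_eq_intros)
    \<comment> \<open>Product rule: one factor becomes \<open>E\<close>, the other is evaluated at
      the identity \<open>?G 0\<close>.\<close>
    have df: "(f has_real_derivative (\<Sum>a<n. \<Sum>b<n. \<Sum>x<n. \<Sum>y<n.
        C $$ (a,b) * E x b * B $$ (x,y) * of_bool (y = a) + C $$ (a,b) * of_bool (x = b) * B $$ (x,y) * E y a)) (at 0)"
      unfolding f_def mtrace_conj_expand[OF C(1) plane_rotation_carrier B(1)]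
      by (intro DERIV_sum) (auto intro!: derivative_eq_intros dG simp: G0)
    have f0: "f 0 = mtrace (C * B)"
    proof -
      have "?G 0 = 1\<^sub>m n"
        using G0 by (intro eq_matI) (auto simp: plane_rotation_def)
      thus ?thesis using B C by (simp add: f_def)
    qed
    have "f 0 \<le> f t" for t
      using min[OF orth_mat_plane_rotation[OF ij False]] unfolding f0 by (simp add: f_def)
    then have "0 = (\<Sum>a<n. \<Sum>b<n. \<Sum>x<n. \<Sum>y<n.
        C $$ (a,b) * E x b * B $$ (x,y) * of_bool (y = a) + C $$ (a,b) * of_bool (x = b) * B $$ (x,y) * E y a)"
      by (intro DERIV_local_min[OF df, of 1, symmetric]) auto
    \<comment> \<open>Each Kronecker delta, in the identity and then in \<open>E\<close>, removes
      one summation; what remains are entries of \<open>B * C\<close> and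
      \<open>C * B\<close>.\<close>
    also have "\<dots> = (\<Sum>a<n. \<Sum>b<n. \<Sum>x<n. C $$ (a,b) * E x b * B $$ (x,a)) +
        (\<Sum>a<n. \<Sum>b<n. \<Sum>y<n. C $$ (a,b) * B $$ (b,y) * E y a)"
    proof -
      have "(\<Sum>x<n. \<Sum>y<n. C $$ (a,b) * of_bool (x = b) * B $$ (x,y) * E y a) =
          (\<Sum>y<n. C $$ (a,b) * B $$ (b,y) * E y a)" if "b < n" for a b
        using that by (subst sum.swap) (auto intro!: sum.cong simp: sum_distrib_left[symmetric] sum_of_bool_mult mult.assoc)
      thus ?thesis by (simp add: sum.distrib sum_of_bool_mult)
    qed
    also have "(\<Sum>a<n. \<Sum>b<n. \<Sum>x<n. C $$ (a,b) * E x b * B $$ (x,a)) =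
        (\<Sum>a<n. C $$ (a,j) * B $$ (i,a)) - (\<Sum>a<n. C $$ (a,i) * B $$ (j,a))"
    proof -
      have "(\<Sum>b<n. \<Sum>x<n. C $$ (a,b) * E x b * B $$ (x,a)) = C $$ (a,j) * B $$ (i,a) - C $$ (a,i) * B $$ (j,a)" for a
      proof -
        have "(\<Sum>x<n. C $$ (a,b) * E x b * B $$ (x,a)) =
           C $$ (a,b) * of_bool (b = j) * B $$ (i,a) - C $$ (a,b) * of_bool (b = i) * B $$ (j,a)" for b
        proof -
          have "(\<Sum>x<n. C $$ (a,b) * E x b * B $$ (x,a)) =
            (\<Sum>x<n. of_bool (x = i) * (C $$ (a,b) * of_bool (b = j) * B $$ (x,a))) -
            (\<Sum>x<n. of_bool (x = j) * (C $$ (a,b) * of_bool (b = i) * B $$ (x,a)))"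
            unfolding E_def sum_subtractf[symmetric] by (intro sum.cong) (auto simp: algebra_simps)
          thus ?thesis using ij by (simp add: sum_of_bool_mult)
        qed
        then have "(\<Sum>b<n. \<Sum>x<n. C $$ (a,b) * E x b * B $$ (x,a)) =
            (\<Sum>b<n. of_bool (b = j) * (C $$ (a,b) * B $$ (i,a))) - (\<Sum>b<n. of_bool (b = i) * (C $$ (a,b) * B $$ (j,a)))"
          unfolding sum_subtractf[symmetric] by (intro sum.cong) (auto simp: algebra_simps)
        thus ?thesis using ij by (simp add: sum_of_bool_mult)
      qed
      thus ?thesis by (simp add: sum_subtractf)
    qed
    also have "(\<Sum>a<n. \<Sum>b<n. \<Sum>y<n. C $$ (a,b) * B $$ (b,y) * E y a) =
        (\<Sum>b<n. C $$ (j,b) * B $$ (b,i)) - (\<Sum>b<n. C $$ (i,b) * B $$ (b,j))"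
    proof -
      have "(\<Sum>y<n. C $$ (a,b) * B $$ (b,y) * E y a) =
         of_bool (a = j) * (C $$ (a,b) * B $$ (b,i)) - of_bool (a = i) * (C $$ (a,b) * B $$ (b,j))" for a b
      proof -
        have "(\<Sum>y<n. C $$ (a,b) * B $$ (b,y) * E y a) =
            (\<Sum>y<n. of_bool (y = i) * (of_bool (a = j) * (C $$ (a,b) * B $$ (b,y)))) -
            (\<Sum>y<n. of_bool (y = j) * (of_bool (a = i) * (C $$ (a,b) * B $$ (b,y))))"
          unfolding E_def sum_subtractf[symmetric] by (intro sum.cong) (auto simp: algebra_simps)
        thus ?thesis using ij by (simp add: sum_of_bool_mult)
      qed
      then show ?thesis
        using ij by (simp add: sum_subtractf sum_distrib_left[symmetric] sum_of_bool_mult)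
    qed
    also have "(\<Sum>a<n. C $$ (a,j) * B $$ (i,a)) = (B * C) $$ (i,j)"
      unfolding index_mult_mat_sum[OF B(1) C(1) ij] by (simp add: mult.commute)
    \<comment> \<open>By symmetry of both factors this \<open>(j,i)\<close> entry of
      \<open>B * C\<close> is the \<open>(i,j)\<close> entry of \<open>C * B\<close>; the next sum
      is treated the same way.\<close>
    also have "(\<Sum>a<n. C $$ (a,i) * B $$ (j,a)) = (C * B) $$ (i,j)"
      unfolding index_mult_mat_sum[OF C(1) B(1) ij] using ij symC symB by (auto intro!: sum.cong)
    also have "(\<Sum>b<n. C $$ (j,b) * B $$ (b,i)) = (B * C) $$ (i,j)"
      unfolding index_mult_mat_sum[OF B(1) C(1) ij] using ij symC symB by (auto intro!: sum.cong)
    also have "(\<Sum>b<n. C $$ (i,b) * B $$ (b,j)) = (C * B) $$ (i,j)"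
      unfolding index_mult_mat_sum[OF C(1) B(1) ij] ..
    finally show ?thesis by simp
  qed
qed (use B C in auto)

text \<open>Reduction to a minimiser at the identity: \<open>R * G\<close> is again orthogonal, and
  conjugating by it means conjugating by \<open>R\<close>, then by \<open>G\<close>.\<close>

lemma mtrace_conj_stationary:
  fixes C K :: "real mat"
  assumes C: "C \<in> carrier_mat n n" "transpose_mat C = C"
    and K: "K \<in> carrier_mat n n" "transpose_mat K = K" and R: "orth_mat n R"
    and min: "\<And>Q. orth_mat n Q \<Longrightarrow>
      mtrace (C * (transpose_mat R * K * R)) \<le> mtrace (C * (transpose_mat Q * K * Q))"
  shows "C * (transpose_mat R * K * R) = (transpose_mat R * K * R) * C"
proof (rule mtrace_conj_stationary_one[OF C])
  note [simp] = orth_matD(1,2)[OF R] K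
    assoc_mult_mat[of _ n n _ n _ n] mult_carrier_mat[of _ n n _ n] transpose_mult[of _ n n _ n]
  show "transpose_mat R * K * R \<in> carrier_mat n n" by simp
  show "transpose_mat (transpose_mat R * K * R) = transpose_mat R * K * R" by simp
  fix G assume G: "orth_mat n G"
  note [simp] = orth_matD(1,2)[OF G]
  show "mtrace (C * (transpose_mat R * K * R)) \<le> mtrace (C * (transpose_mat G * (transpose_mat R * K * R) * G))"
    using min[OF orth_mat_mult[OF R G]] by simp
qed

section \<open>Diagonal matrices: commutants and swaps of entries\<close>

lemma commute_mat_diag_imp_diagonal:
  fixes A :: "real mat"
  assumes A: "A \<in> carrier_mat n n" and comm: "mat_diag n f * A = A * mat_diag n f"
    and inj: "inj_on f {..<n}"
  shows "A = mat_diag n (\<lambda>i. A $$ (i,i))"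
proof (rule eq_matI)
  fix i j assume ij: "i < dim_row (mat_diag n (\<lambda>i. A $$ (i,i)))" "j < dim_col (mat_diag n (\<lambda>i. A $$ (i,i)))"
  then have ij: "i < n" "j < n" by (auto simp: mat_diag_def)
  have "(mat_diag n f * A) $$ (i,j) = (A * mat_diag n f) $$ (i,j)" using comm by simp
  then have "f i * A $$ (i,j) = A $$ (i,j) * f j"
    using ij by (simp add: mat_diag_mult_left[OF A] mat_diag_mult_right[OF A])
  moreover have "f i \<noteq> f j" if "i \<noteq> j" using inj ij that by (auto simp: inj_on_def)
  ultimately show "A $$ (i,j) = mat_diag n (\<lambda>i. A $$ (i,i)) $$ (i,j)"
    using ij by auto
qed (use A in \<open>auto simp: mat_diag_def\<close>)

text \<open>The permutation matrix of a transposition supplies a competitor: comparing a minimiser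
  with its product by \<open>S\<close> orders two diagonal entries.\<close>

lemma orth_mat_swap:
  assumes "i < n" "j < n"
  obtains S where "orth_mat n S"
    "\<And>b :: nat \<Rightarrow> real. transpose_mat S * mat_diag n b * S = mat_diag n (\<lambda>x. b (Transposition.transpose i j x))"
proof
  define S where "S = mat n n (\<lambda>(a,b). of_bool (a = Transposition.transpose i j b) :: real)"
  have c: "S \<in> carrier_mat n n" "transpose_mat S \<in> carrier_mat n n" by (auto simp: S_def)
  have tr: "Transposition.transpose i j x < n" if "x < n" for x
    using that assms by (auto simp: Transposition.transpose_def)
  show conj: "transpose_mat S * mat_diag n b * S = mat_diag n (\<lambda>x. b (Transposition.transpose i j x))" for b :: "nat \<Rightarrow> real"
  proof (rule eq_matI)
    fix x y assume "x < dim_row (mat_diag n (\<lambda>x. b (Transposition.transpose i j x)))"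
      "y < dim_col (mat_diag n (\<lambda>x. b (Transposition.transpose i j x)))"
    then have xy: "x < n" "y < n" by (auto simp: mat_diag_def)
    have "(transpose_mat S * mat_diag n b * S) $$ (x,y) =
        (\<Sum>a<n. of_bool (a = Transposition.transpose i j x) * (b a * of_bool (a = Transposition.transpose i j y)))"
    proof -
      have "(transpose_mat S * mat_diag n b) $$ (x,a) = of_bool (a = Transposition.transpose i j x) * b a"
        "S $$ (a,y) = of_bool (a = Transposition.transpose i j y)" if "a < n" for a
        using that xy by (simp_all add: mat_diag_mult_right[OF c(2)]) (simp_all add: S_def)
      thus ?thesis
        by (subst index_mult_mat_sum[OF mult_carrier_mat[OF c(2) mat_diag_dim] c(1) xy])
          (intro sum.cong refl, simp add: mult.assoc)
    qed
    also have "\<dots> = b (Transposition.transpose i j x) * of_bool (Transposition.transpose i j x = Transposition.transpose i j y)"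
      using tr[OF xy(1)] by (simp add: sum_of_bool_mult)
    finally show "(transpose_mat S * mat_diag n b * S) $$ (x,y) = mat_diag n (\<lambda>x. b (Transposition.transpose i j x)) $$ (x,y)"
      using xy by (simp add: inj_eq[OF inj_transpose])
  qed (use c in \<open>auto simp: mat_diag_def\<close>)
  \<comment> \<open>Conjugating the identity, written as the constant diagonal 1, yields
    orthogonality.\<close>
  show "orth_mat n S"
    using conj[of "\<lambda>_. 1"] c mat_mult_left_right_inverse[OF c(2,1)] by (simp add: orth_mat_def)
qed

text \<open>The exchange step of the rearrangement inequality: only the terms at \<open>i\<close>
  and \<open>j\<close> change, so the sign at a minimiser relates the order of \<open>b\<close> to
  that of \<open>c\<close>.\<close>

lemma sum_mult_transposition_diff:
  fixes c b :: "nat \<Rightarrow> real"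
  assumes ij: "i < n" "j < n" "i \<noteq> j"
  shows "(\<Sum>x<n. c x * b (Transposition.transpose i j x)) - (\<Sum>x<n. c x * b x) = (c j - c i) * (b i - b j)"
proof -
  have "(\<Sum>x<n. c x * b (Transposition.transpose i j x)) - (\<Sum>x<n. c x * b x) =
     (\<Sum>x<n. c x * (b (Transposition.transpose i j x) - b x))"
    by (simp add: sum_subtractf algebra_simps)
  also have "\<dots> = (\<Sum>x\<in>{i,j}. c x * (b (Transposition.transpose i j x) - b x))"
    using ij by (intro sum.mono_neutral_right) auto
  also have "\<dots> = (c j - c i) * (b i - b j)" using ij by (simp add: algebra_simps)
  finally show ?thesis .
qed

lemma conj_mat_diag_cancel:
  assumes U: "orth_mat n U" and A: "A = U * mat_diag n d * transpose_mat U"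
  shows "transpose_mat U * A * U = mat_diag n d"
proof -
  note [simp] = orth_matD[OF U] orth_mat_cancel[OF U, of _ n]
    assoc_mult_mat[of _ n n _ n _ n] mult_carrier_mat[of _ n n _ n] right_mult_one_mat[of _ n n] left_mult_one_mat[of _ n n]
  show ?thesis unfolding A by simp
qed

lemma conj_mat_diag_uncancel:
  assumes U: "orth_mat n U" and A: "A \<in> carrier_mat n n" and d: "transpose_mat U * A * U = mat_diag n d"
  shows "A = U * mat_diag n d * transpose_mat U"
proof -
  note [simp] = orth_matD[OF U] orth_mat_cancel[OF U, of _ n]
    assoc_mult_mat[of _ n n _ n _ n] mult_carrier_mat[of _ n n _ n] A right_mult_one_mat[of _ n n] left_mult_one_mat[of _ n n]
  show ?thesis unfolding d[symmetric] by simp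
qed

text \<open>The distinct entries of \<open>?N\<close> force the minimising conjugate to be diagonal;
  since they increase, exchanging two entries shows that the eigenvalues come out in decreasing
  order.\<close>

lemma real_symmetric_diagonalization:
  fixes A :: "real mat"
  assumes A: "A \<in> carrier_mat n n" "transpose_mat A = A"
  obtains U d where "orth_mat n U" "\<And>i j. i < j \<Longrightarrow> j < n \<Longrightarrow> d j \<le> d i"
    "A = U * mat_diag n d * transpose_mat U"
proof -
  let ?N = "mat_diag n real"
  let ?F = "\<lambda>Q. mtrace (?N * (transpose_mat Q * A * Q))"
  obtain R where R: "orth_mat n R" "\<And>Q. orth_mat n Q \<Longrightarrow> ?F R \<le> ?F Q"
  proof (rule orth_mat_minimizer[of n ?F])
    fix Q R assume "\<And>k. orth_mat n (Q k)" "orth_mat n R" and Q: "mat_tendsto n Q R"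
    have "(\<lambda>k. ?F (Q k)) \<longlonglongrightarrow> ?F R"
      using A(1) Q by (intro mat_tendsto_mtrace mat_tendsto_mult mat_tendsto_transpose mat_tendsto_const) auto
    thus "\<exists>f::nat \<Rightarrow> nat. strict_mono f \<and> (\<lambda>k. ?F (Q (f k))) \<longlonglongrightarrow> ?F R"
      by (intro exI[of _ id]) (auto simp: strict_mono_def)
  qed auto
  let ?B = "transpose_mat R * A * R"
  note [simp] = orth_matD(1,2)[OF R(1)] A(1)
    assoc_mult_mat[of _ n n _ n _ n] mult_carrier_mat[of _ n n _ n] transpose_mult[of _ n n _ n]
  have "?N * ?B = ?B * ?N"
    using R A by (intro mtrace_conj_stationary) auto
  then obtain b where b: "?B = mat_diag n b"
    using commute_mat_diag_imp_diagonal[of ?B n real] by (auto simp: inj_on_def)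
  have "b j \<le> b i" if ij: "i < j" "j < n" for i j
  proof -
    obtain S where S: "orth_mat n S"
      "\<And>b :: nat \<Rightarrow> real. transpose_mat S * mat_diag n b * S = mat_diag n (\<lambda>x. b (Transposition.transpose i j x))"
      by (rule orth_mat_swap[of i n j]) (use ij in auto)
    note [simp] = orth_matD(1,2)[OF S(1)]
    have "transpose_mat (R * S) * A * (R * S) = transpose_mat S * ?B * S" by simp
    then have "?F (R * S) = (\<Sum>x<n. real x * b (Transposition.transpose i j x))"
      unfolding b by (simp only: S(2) mat_diag_diag mtrace_mat_diag)
    moreover have "?F R = (\<Sum>x<n. real x * b x)"
      unfolding b by (simp only: mat_diag_diag mtrace_mat_diag)
    ultimately have "0 \<le> (real j - real i) * (b i - b j)"
      using R(2)[OF orth_mat_mult[OF R(1) S(1)]] sum_mult_transposition_diff[of i n j real b] that by simp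
    thus ?thesis using that by (simp add: zero_le_mult_iff)
  qed
  thus ?thesis using that[OF R(1)] conj_mat_diag_uncancel[OF R(1) A(1) b] by blast
qed

subsection \<open>Positive semidefinite matrices and their powers\<close>

text \<open>Positive semidefiniteness is encoded by the very condition from which
  \<open>psd_power\<close> chooses, so that the choice is known to have a candidate.\<close>

definition psd_mat :: "nat \<Rightarrow> real mat \<Rightarrow> bool" where
  "psd_mat n A \<longleftrightarrow> (\<exists>U d. orth_mat n U \<and> (\<forall>i<n. 0 \<le> d i) \<and> A = U * mat_diag n d * transpose_mat U)"

text \<open>The entry \<open>d i\<close> is the squared norm of column \<open>i\<close> of
  \<open>Z * U\<close>.\<close>

lemma gram_diagonalization_nonneg:
  assumes Z: "Z \<in> carrier_mat m n" and U: "orth_mat n U"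
    and eq: "transpose_mat Z * Z = U * mat_diag n d * transpose_mat U" and i: "i < n"
  shows "0 \<le> (d i :: real)"
proof -
  note c = orth_matD(1,2)[OF U]
  have ZU: "Z * U \<in> carrier_mat m n" "transpose_mat (Z * U) \<in> carrier_mat n m" using Z c by auto
  have "transpose_mat (Z * U) * (Z * U) = transpose_mat U * (transpose_mat Z * Z) * U"
    using Z c by (simp add: transpose_mult[OF Z c(1)] assoc_mult_mat[of _ n m _ n _ n]
       assoc_mult_mat[of _ n n _ m _ n] assoc_mult_mat[of _ n n _ n _ n])
  also have "\<dots> = mat_diag n d"
    by (rule conj_mat_diag_cancel[OF U eq])
  finally have "d i = (transpose_mat (Z * U) * (Z * U)) $$ (i,i)" using i by simp
  also have "\<dots> = (\<Sum>x<m. ((Z * U) $$ (x,i))\<^sup>2)"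
  proof -
    have "transpose_mat (Z * U) $$ (i,x) = (Z * U) $$ (x,i)" if "x < m" for x
      using ZU that i by (intro index_transpose_mat(1)) auto
    thus ?thesis by (subst index_mult_mat_sum[OF ZU(2,1) i i])
        (intro sum.cong refl, simp add: power2_eq_square del: index_mult_mat(1))
  qed
  finally show ?thesis by (simp add: sum_nonneg)
qed

lemma psd_mat_gram:
  assumes Z: "Z \<in> carrier_mat m n"
  shows "psd_mat n (transpose_mat Z * Z)"
proof -
  have 1: "transpose_mat Z * Z \<in> carrier_mat n n" using Z by simp
  have 2: "transpose_mat (transpose_mat Z * Z) = transpose_mat Z * Z"
    using Z by (simp add: transpose_mult[of _ n m _ n])
  obtain U d where U: "orth_mat n U" "transpose_mat Z * Z = U * mat_diag n d * transpose_mat U"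
    by (rule real_symmetric_diagonalization[OF 1 2])
  thus ?thesis using gram_diagonalization_nonneg[OF Z U] unfolding psd_mat_def by blast
qed

text \<open>With \<open>?S\<close> the square root of the diagonal, \<open>A\<close> is the Gram
  matrix of \<open>?S U^T\<close>, and its conjugate is the Gram matrix of
  \<open>?S U^T D\<close>.\<close>

lemma psd_mat_conj:
  assumes A: "psd_mat n A" and D: "D \<in> carrier_mat n n"
  shows "psd_mat n (transpose_mat D * A * D)"
proof -
  obtain U d where U: "orth_mat n U" and d: "\<And>i. i < n \<Longrightarrow> 0 \<le> d i"
    and A: "A = U * mat_diag n d * transpose_mat U"
    using A unfolding psd_mat_def by blast
  let ?S = "mat_diag n (\<lambda>i. sqrt (d i))"
  note [simp] = orth_matD(1,2)[OF U] D
    assoc_mult_mat[of _ n n _ n _ n] mult_carrier_mat[of _ n n _ n] transpose_mult[of _ n n _ n]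
  have "?S * (?S * X) = mat_diag n d * X" if "X \<in> carrier_mat n n" for X
  proof -
    have "?S * ?S = mat_diag n d"
      unfolding mat_diag_diag using d by (intro mat_diag_cong) simp
    thus ?thesis using assoc_mult_mat[OF mat_diag_dim mat_diag_dim that] by metis
  qed
  then have "transpose_mat D * A * D = transpose_mat (?S * transpose_mat U * D) * (?S * transpose_mat U * D)"
    unfolding A by simp
  thus ?thesis using psd_mat_gram[of "?S * transpose_mat U * D" n n] by simp
qed

text \<open>Similarity preserves the characteristic polynomial, so the diagonal entries with
  multiplicity depend on the conjugated matrix alone, not on the diagonalisation.\<close>

lemma proots_char_poly_conj_diag:
  fixes d :: "nat \<Rightarrow> real"
  assumes U: "orth_mat n U"
  shows "proots (char_poly (U * mat_diag n d * transpose_mat U)) = mset (map d [0..<n])"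
proof -
  have "similar_mat (U * mat_diag n d * transpose_mat U) (mat_diag n d)"
    unfolding similar_mat_def similar_mat_wit_def using orth_matD[OF U]
    by (intro exI[of _ U] exI[of _ "transpose_mat U"]) (auto simp: Let_def)
  then have "char_poly (U * mat_diag n d * transpose_mat U) = char_poly (mat_diag n d)"
    by (rule char_poly_similar)
  also have "\<dots> = (\<Prod>a\<leftarrow>diag_mat (mat_diag n d). [:- a, 1:])"
    by (rule char_poly_upper_triangular[OF mat_diag_dim]) (auto simp: upper_triangular_def mat_diag_def)
  also have "diag_mat (mat_diag n d) = map d [0..<n]"
    by (auto simp: diag_mat_def mat_diag_def)
  finally have eq: "char_poly (U * mat_diag n d * transpose_mat U) = (\<Prod>a\<leftarrow>map d [0..<n]. [:- a, 1:])" .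
  have "proots (\<Prod>a\<leftarrow>xs. [:- a, 1:]) = mset xs" for xs :: "real list"
  proof (induction xs)
    case (Cons a xs)
    have "(\<Prod>a\<leftarrow>xs. [:- a, 1:]) \<noteq> 0" by (auto simp: prod_list_zero_iff)
    thus ?case using Cons by (simp add: proots_mult del: mult_pCons_left)
  qed simp
  thus ?thesis unfolding eq .
qed

text \<open>Ties a diagonalisation in decreasing order to the list used in
  \<open>gram_eigs_desc\<close>.\<close>

lemma sorted_eigenvalues_conj_diag:
  fixes d :: "nat \<Rightarrow> real"
  assumes U: "orth_mat n U" and desc: "\<And>i j. i < j \<Longrightarrow> j < n \<Longrightarrow> d j \<le> d i"
  shows "rev (sorted_list_of_multiset (proots (char_poly (U * mat_diag n d * transpose_mat U)))) = map d [0..<n]"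
proof -
  have "sorted (rev (map d [0..<n]))"
    unfolding sorted_rev_iff_nth_mono using desc by (auto simp: le_less)
  then have "sorted_list_of_multiset (mset (rev (map d [0..<n]))) = rev (map d [0..<n])"
    by (simp only: sorted_list_of_multiset_mset sorted_sort_id)
  thus ?thesis unfolding proots_char_poly_conj_diag[OF U] by simp
qed

lemma mtrace_conj_mat_diag:
  assumes U: "orth_mat n U"
  shows "mtrace (U * mat_diag n f * transpose_mat U) = (\<Sum>i<n. f i)"
proof -
  have "mtrace (U * mat_diag n f * transpose_mat U) = mtrace (transpose_mat U * (U * mat_diag n f))"
    using orth_matD(1,2)[OF U] by (intro mtrace_mult_commute[of _ n n]) auto
  thus ?thesis by (simp add: orth_mat_cancel[OF U mat_diag_dim] mtrace_mat_diag)
qed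

section \<open>Principal powers and their traces\<close>

lemma psd_power_diagonalization:
  assumes "psd_mat n A"
  obtains U d where "orth_mat n U" "\<forall>i<n. 0 \<le> d i" "A = U * mat_diag n d * transpose_mat U"
    "psd_power A r = U * mat_diag n (\<lambda>i. d i powr r) * transpose_mat U"
proof -
  have n: "dim_row A = n" using assms by (auto simp: psd_mat_def dest: orth_matD)
  have "\<exists>B U d. orth_mat n U \<and> (\<forall>i<n. 0 \<le> d i) \<and> A = U * mat_diag n d * transpose_mat U \<and>
      B = U * mat_diag n (\<lambda>i. d i powr r) * transpose_mat U"
    using assms unfolding psd_mat_def by blast
  from someI_ex[OF this] show ?thesis
    using that unfolding psd_power_def n by blast
qed

text \<open>The diagonalisation chosen inside \<open>psd_power\<close> may differ from
  \<open>U\<close> and \<open>d\<close>, but both have the same multiset of eigenvalues, hence equal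
  sums of powers.\<close>

lemma mtrace_psd_power:
  assumes U: "orth_mat n U" and d: "\<And>i. i < n \<Longrightarrow> 0 \<le> d i" and A: "A = U * mat_diag n d * transpose_mat U"
  shows "mtrace (psd_power A r) = (\<Sum>i<n. d i powr r)"
proof -
  have "psd_mat n A" using assms unfolding psd_mat_def by blast
  then obtain V e where V: "orth_mat n V" "A = V * mat_diag n e * transpose_mat V"
    "psd_power A r = V * mat_diag n (\<lambda>i. e i powr r) * transpose_mat V"
    by (rule psd_power_diagonalization)
  have "mset (map e [0..<n]) = mset (map d [0..<n])"
    using proots_char_poly_conj_diag[OF U, of d] proots_char_poly_conj_diag[OF V(1), of e]
    unfolding A[symmetric] V(2)[symmetric] by simp
  then have "mset (map (\<lambda>x. x powr r) (map e [0..<n])) = mset (map (\<lambda>x. x powr r) (map d [0..<n]))"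
    by (simp only: mset_map)
  then have "sum_list (map (\<lambda>x. x powr r) (map e [0..<n])) = sum_list (map (\<lambda>x. x powr r) (map d [0..<n]))"
    by (metis sum_mset_sum_list)
  then have "(\<Sum>i<n. e i powr r) = (\<Sum>i<n. d i powr r)"
    by (simp add: interv_sum_list_conv_sum_set_nat o_def atLeast0LessThan)
  thus ?thesis unfolding V(3) mtrace_conj_mat_diag[OF V(1)] .
qed

text \<open>Comparing entries of \<open>U diag(d) = diag(a) U\<close>, a nonzero
  \<open>U $$ (i,j)\<close> forces \<open>d j = a i\<close>, and then \<open>g\<close> takes equal
  values there too.\<close>

lemma conj_mat_diag_map:
  fixes g :: "real \<Rightarrow> real"
  assumes U: "orth_mat n U" and eq: "U * mat_diag n d * transpose_mat U = mat_diag n a"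
  shows "U * mat_diag n (\<lambda>i. g (d i)) * transpose_mat U = mat_diag n (\<lambda>i. g (a i))"
proof -
  note c = orth_matD[OF U]
  note [simp] = c assoc_mult_mat[of _ n n _ n _ n] mult_carrier_mat[of _ n n _ n]
    right_mult_one_mat[of _ n n] left_mult_one_mat[of _ n n]
  have *: "U * mat_diag n d = mat_diag n a * U"
    unfolding eq[symmetric] by simp
  have "U * mat_diag n (\<lambda>i. g (d i)) = mat_diag n (\<lambda>i. g (a i)) * U"
  proof (rule eq_matI)
    fix i j assume "i < dim_row (mat_diag n (\<lambda>i. g (a i)) * U)" "j < dim_col (mat_diag n (\<lambda>i. g (a i)) * U)"
    then have ij: "i < n" "j < n" using c by (auto simp: mat_diag_def)
    have "(U * mat_diag n d) $$ (i,j) = (mat_diag n a * U) $$ (i,j)" using * by simp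
    then have "U $$ (i,j) * d j = a i * U $$ (i,j)"
      using ij by (simp add: mat_diag_mult_left[OF c(1)] mat_diag_mult_right[OF c(1)])
    then have "U $$ (i,j) * g (d j) = g (a i) * U $$ (i,j)" by auto
    thus "(U * mat_diag n (\<lambda>i. g (d i))) $$ (i,j) = (mat_diag n (\<lambda>i. g (a i)) * U) $$ (i,j)"
      using ij by (simp add: mat_diag_mult_left[OF c(1)] mat_diag_mult_right[OF c(1)])
  qed (use carrier_matD[OF c(1)] in \<open>auto simp: mat_diag_def\<close>)
  thus ?thesis by simp
qed

lemma psd_power_mat_diag:
  assumes "\<And>i. i < n \<Longrightarrow> 0 \<le> a i"
  shows "psd_power (mat_diag n a) r = mat_diag n (\<lambda>i. a i powr r)"
proof -
  have "psd_mat n (mat_diag n a)"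
    unfolding psd_mat_def using assms orth_mat_one
    by (intro exI[of _ "1\<^sub>m n"] exI[of _ a]) (auto simp: right_mult_one_mat[OF mat_diag_dim] left_mult_one_mat[OF mat_diag_dim])
  then obtain U d where U: "orth_mat n U" "mat_diag n a = U * mat_diag n d * transpose_mat U"
    "psd_power (mat_diag n a) r = U * mat_diag n (\<lambda>i. d i powr r) * transpose_mat U"
    by (rule psd_power_diagonalization)
  show ?thesis
    unfolding U(3) by (rule conj_mat_diag_map[OF U(1) U(2)[symmetric]])
qed

text \<open>Compactness makes the diagonalising matrices converge along a subsequence; the
  eigenvalues, as diagonal entries of the conjugates, then converge as well.\<close>

lemma mtrace_psd_power_convergent_subseq:
  assumes M: "\<And>k. psd_mat n (M k)" and lim: "mat_tendsto n M L" and r: "0 < r"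
  shows "\<exists>f::nat \<Rightarrow> nat. strict_mono f \<and>
    (\<lambda>k. mtrace (psd_power (M (f k)) r)) \<longlonglongrightarrow> mtrace (psd_power L r)"
proof -
  have "\<exists>U d. orth_mat n U \<and> (\<forall>i<n. 0 \<le> d i) \<and> M k = U * mat_diag n d * transpose_mat U" for k
    using M[of k] unfolding psd_mat_def .
  then obtain U d where U: "\<And>k. orth_mat n (U k)" and d: "\<And>k i. i < n \<Longrightarrow> 0 \<le> d k i"
    and Mk: "\<And>k. M k = U k * mat_diag n (d k) * transpose_mat (U k)" by metis
  obtain f V where f: "strict_mono (f::nat \<Rightarrow> nat)" and V: "orth_mat n V" and UV: "mat_tendsto n (\<lambda>k. U (f k)) V"
    using orth_mat_convergent_subseq[of n U] U by blast
  let ?E = "transpose_mat V * L * V"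
  have "mat_tendsto n (\<lambda>k. transpose_mat (U (f k)) * M (f k) * U (f k)) ?E"
    by (intro mat_tendsto_mult mat_tendsto_transpose UV mat_tendsto_subseq[OF lim f])
  then have E: "mat_tendsto n (\<lambda>k. mat_diag n (d (f k))) ?E"
    unfolding conj_mat_diag_cancel[OF U Mk] .
  define e where "e i = ?E $$ (i,i)" for i
  have de: "(\<lambda>k. d (f k) i) \<longlonglongrightarrow> e i" if "i < n" for i
  proof -
    have "(\<lambda>k. mat_diag n (d (f k)) $$ (i,i)) \<longlonglongrightarrow> ?E $$ (i,i)"
      using E that unfolding mat_tendsto_def by blast
    thus ?thesis using that by (simp add: e_def)
  qed
  have e0: "0 \<le> e i" if "i < n" for i
    using d that by (intro LIMSEQ_le_const[OF de[OF that]]) auto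
  have "?E = mat_diag n e"
    by (rule mat_tendsto_unique[OF E mat_tendsto_diag[OF de]])
  moreover have "L \<in> carrier_mat n n" using lim by (simp add: mat_tendsto_def)
  ultimately have L: "L = V * mat_diag n e * transpose_mat V"
    using conj_mat_diag_uncancel[OF V] by blast
  \<comment> \<open>An eigenvalue may tend to 0; there \<open>0 < r\<close> gives continuity of
    \<open>x powr r\<close>.\<close>
  have "(\<lambda>k. \<Sum>i<n. d (f k) i powr r) \<longlonglongrightarrow> (\<Sum>i<n. e i powr r)"
    using d r by (intro tendsto_sum tendsto_powr' de) auto
  then have "(\<lambda>k. mtrace (psd_power (M (f k)) r)) \<longlonglongrightarrow> mtrace (psd_power L r)"
    by (simp only: mtrace_psd_power[OF U d Mk] mtrace_psd_power[OF V e0 L])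
  thus ?thesis using f by blast
qed

text \<open>The graph of the concave \<open>x powr s\<close> lies below its tangent at
  \<open>y\<close>: multiply Young's inequality for \<open>x\<close> and \<open>y\<close> with
  weights \<open>s\<close> and \<open>1 - s\<close> by \<open>y powr (s - 1)\<close>.\<close>

lemma powr_le_tangent:
  fixes x y s :: real
  assumes s: "0 < s" "s \<le> 1" and x: "0 \<le> x" and y: "0 < y"
  shows "x powr s \<le> s * (y powr (s - 1) * x) + (1 - s) * y powr s"
proof (cases "x = 0")
  case False
  with x have x: "0 < x" by simp
  have "x powr s = (x powr s * y powr (1 - s)) * y powr (s - 1)"
    using y by (simp add: mult.assoc flip: powr_add)
  also have "\<dots> \<le> (s * x + (1 - s) * y) * y powr (s - 1)"
    using Youngs_inequality_0[of s "1 - s" x y] s x y by (intro mult_right_mono) auto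
  also have "\<dots> = s * (y powr (s - 1) * x) + (1 - s) * (y powr 1 * y powr (s - 1))"
    using y by (simp add: algebra_simps)
  also have "y powr 1 * y powr (s - 1) = y powr s"
    unfolding powr_add[symmetric] by simp
  finally show ?thesis .
qed (use s in simp)

text \<open>In an orthogonal change of basis the squared entries are doubly stochastic weights,
  so the scalar tangent inequality for the concave function \<open>x powr s\<close> can be averaged.\<close>

lemma mtrace_powr_le_tangent:
  assumes U: "orth_mat n U" and V: "orth_mat n V" and s: "0 < s" "s \<le> 1"
    and \<mu>: "\<And>i. i < n \<Longrightarrow> 0 < \<mu> i" and \<nu>: "\<And>i. i < n \<Longrightarrow> 0 \<le> \<nu> i"
  shows "(\<Sum>i<n. \<nu> i powr s) \<le>
    s * mtrace (U * mat_diag n (\<lambda>i. \<mu> i powr (s - 1)) * transpose_mat U * (V * mat_diag n \<nu> * transpose_mat V))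
    + (1 - s) * (\<Sum>i<n. \<mu> i powr s)"
proof -
  let ?D = "mat_diag n (\<lambda>i. \<mu> i powr (s - 1))"
  \<comment> \<open>\<open>P\<close> expresses the basis \<open>V\<close> in the basis
    \<open>U\<close>; cyclicity turns the trace into a sum weighted by the squares of its
    entries.\<close>
  define P where "P = transpose_mat U * V"
  note [simp] = orth_matD[OF U] orth_matD[OF V]
    assoc_mult_mat[of _ n n _ n _ n] mult_carrier_mat[of _ n n _ n] transpose_mult[of _ n n _ n]
  have orthP: "orth_mat n P" unfolding P_def by (intro orth_mat_mult orth_mat_transpose U V)
  note cP = orth_matD(1,2)[OF orthP]
  have "U * ?D * transpose_mat U * (V * mat_diag n \<nu> * transpose_mat V) =
      U * (?D * transpose_mat U * (V * mat_diag n \<nu> * transpose_mat V))" by simp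
  also have "mtrace \<dots> = mtrace (?D * transpose_mat U * (V * mat_diag n \<nu> * transpose_mat V) * U)"
    by (rule mtrace_mult_commute[of _ n n]) auto
  also have "?D * transpose_mat U * (V * mat_diag n \<nu> * transpose_mat V) * U = (?D * P) * (mat_diag n \<nu> * transpose_mat P)"
    unfolding P_def by simp
  also have "mtrace \<dots> = (\<Sum>j<n. \<Sum>i<n. (?D * P) $$ (j,i) * (mat_diag n \<nu> * transpose_mat P) $$ (i,j))"
    using cP by (intro mtrace_mult) auto
  also have "\<dots> = (\<Sum>j<n. \<Sum>i<n. (P $$ (j,i))\<^sup>2 * (\<mu> j powr (s - 1) * \<nu> i))"
    using cP by (auto intro!: sum.cong simp: mat_diag_mult_left[OF cP(1)] mat_diag_mult_left[OF cP(2)]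
        power2_eq_square)
  finally have tr: "mtrace (U * ?D * transpose_mat U * (V * mat_diag n \<nu> * transpose_mat V)) =
    (\<Sum>j<n. \<Sum>i<n. (P $$ (j,i))\<^sup>2 * (\<mu> j powr (s - 1) * \<nu> i))" .
  \<comment> \<open>The squares in each column of \<open>P\<close> sum to 1, which introduces the
    weights; the row sums later remove them from the constant term.\<close>
  have "(\<Sum>i<n. \<nu> i powr s) = (\<Sum>i<n. (\<Sum>j<n. (P $$ (j,i))\<^sup>2) * \<nu> i powr s)"
    by (intro sum.cong refl) (subst orth_mat_col_norm[OF orthP], auto)
  also have "\<dots> = (\<Sum>j<n. \<Sum>i<n. (P $$ (j,i))\<^sup>2 * \<nu> i powr s)"
    by (subst sum.swap) (simp add: sum_distrib_right)
  also have "\<dots> \<le> (\<Sum>j<n. \<Sum>i<n. (P $$ (j,i))\<^sup>2 * (s * (\<mu> j powr (s - 1) * \<nu> i) + (1 - s) * \<mu> j powr s))"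
    using s \<mu> \<nu> by (intro sum_mono mult_left_mono powr_le_tangent) auto
  also have "\<dots> = s * (\<Sum>j<n. \<Sum>i<n. (P $$ (j,i))\<^sup>2 * (\<mu> j powr (s - 1) * \<nu> i)) +
      (1 - s) * (\<Sum>j<n. (\<Sum>i<n. (P $$ (j,i))\<^sup>2) * \<mu> j powr s)"
    by (simp add: sum.distrib sum_distrib_left sum_distrib_right distrib_left mult.left_commute
        del: index_mult_mat(1))
  also have "(\<Sum>j<n. (\<Sum>i<n. (P $$ (j,i))\<^sup>2) * \<mu> j powr s) = (\<Sum>j<n. \<mu> j powr s)"
    by (intro sum.cong refl) (subst orth_mat_row_norm[OF orthP], auto)
  finally show ?thesis unfolding tr .
qed

section \<open>Determinants of diagonalised matrices\<close>

lemma det_mat_diag: "det (mat_diag n (f :: nat \<Rightarrow> real)) = (\<Prod>i<n. f i)"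
proof -
  have "det (mat_diag n f) = prod_list (diag_mat (mat_diag n f))"
    by (rule det_upper_triangular[OF _ mat_diag_dim]) (auto simp: upper_triangular_def mat_diag_def)
  thus ?thesis by (simp add: prod_list_diag_prod mat_diag_def atLeast0LessThan)
qed

lemma det_conj_mat_diag:
  assumes U: "orth_mat n U"
  shows "det (U * mat_diag n (f :: nat \<Rightarrow> real) * transpose_mat U) = (\<Prod>i<n. f i)"
proof -
  note c = orth_matD[OF U]
  have "det U * det (transpose_mat U) = 1"
    using det_mult[OF c(1,2)] by (simp add: c(4) det_one)
  moreover have "det (U * mat_diag n f * transpose_mat U) = det U * det (mat_diag n f) * det (transpose_mat U)"
    using c by (simp add: det_mult[of _ n] del: assoc_mult_mat)
  ultimately show ?thesis by (simp add: det_mat_diag)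
qed

subsection \<open>The minimum over the orthogonal group\<close>

text \<open>The generic case, with \<open>d\<close> as the diagonal of \<open>W^(1/p)\<close>.
  Positivity makes \<open>M R\<close> invertible, so that its power \<open>s - 1\<close> makes
  sense; distinctness of the \<open>d i\<close> yields diagonality. The bound is the value at a
  minimiser.\<close>

lemma mtrace_psd_power_ge_strict:
  assumes s: "0 < s" "s \<le> 1"
    and d: "\<And>i. i < n \<Longrightarrow> 0 < d i" "\<And>i j. i < j \<Longrightarrow> j < n \<Longrightarrow> d i < d j"
    and V: "orth_mat n V" and lam: "\<And>i. i < n \<Longrightarrow> 0 < lam i" "\<And>i j. i < j \<Longrightarrow> j < n \<Longrightarrow> lam j \<le> lam i"
    and K: "K = V * mat_diag n lam * transpose_mat V" and Q: "orth_mat n Q"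
  shows "(\<Sum>i<n. (d i * lam i * d i) powr s) \<le>
    mtrace (psd_power (mat_diag n d * transpose_mat Q * K * Q * mat_diag n d) s)"
proof -
  let ?D = "mat_diag n d"
  define M where "M Q = ?D * transpose_mat Q * K * Q * ?D" for Q
  define F where "F Q = mtrace (psd_power (M Q) s)" for Q
  note [simp] = orth_matD(1,2)[OF V] assoc_mult_mat[of _ n n _ n _ n] mult_carrier_mat[of _ n n _ n]
    transpose_mult[of _ n n _ n] right_mult_one_mat[of _ n n] left_mult_one_mat[of _ n n]
  have cK [simp]: "K \<in> carrier_mat n n" and symK: "transpose_mat K = K"
    by (simp_all add: K)
  have psdK: "psd_mat n K" unfolding psd_mat_def using V K lam(1) less_imp_le by blast
  have psdM: "psd_mat n (M Q)" if "orth_mat n Q" for Q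
  proof -
    note [simp] = orth_matD(1,2)[OF that]
    have "M Q = transpose_mat (Q * ?D) * K * (Q * ?D)" by (simp add: M_def)
    thus ?thesis using psd_mat_conj[OF psdK, of "Q * ?D"] by simp
  qed
  have detK: "det K \<noteq> 0" "det ?D \<noteq> 0"
    unfolding K det_conj_mat_diag[OF V] det_mat_diag using lam(1) d(1)
    by (simp_all add: less_imp_neq[symmetric])
  obtain R where R: "orth_mat n R" and min: "\<And>Q. orth_mat n Q \<Longrightarrow> F R \<le> F Q"
  proof (rule orth_mat_minimizer[of n F])
    fix Q R assume Q: "\<And>k. orth_mat n (Q k)" and "orth_mat n R" and lim: "mat_tendsto n Q R"
    have MQR: "mat_tendsto n (\<lambda>k. M (Q k)) (M R)"
      unfolding M_def by (intro mat_tendsto_mult mat_tendsto_transpose mat_tendsto_const lim) auto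
    show "\<exists>f::nat \<Rightarrow> nat. strict_mono f \<and> (\<lambda>k. F (Q (f k))) \<longlonglongrightarrow> F R"
      unfolding F_def by (rule mtrace_psd_power_convergent_subseq[OF psdM[OF Q] MQR s(1)])
  qed auto
  note [simp] = orth_matD(1,2)[OF R]
  define B where "B = transpose_mat R * K * R"
  have cB [simp]: "B \<in> carrier_mat n n" by (simp add: B_def)
  have MB: "M R = ?D * B * ?D" by (simp add: M_def B_def)
  obtain U \<mu> where U: "orth_mat n U" and \<mu>0: "\<forall>i<n. 0 \<le> \<mu> i" and MU: "M R = U * mat_diag n \<mu> * transpose_mat U"
    using psdM[OF R] unfolding psd_mat_def by blast
  note [simp] = orth_matD(1,2)[OF U] orth_mat_cancel[OF U, of _ n]
  \<comment> \<open>The determinant of \<open>M R\<close> is \<open>det K\<close> times the square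
    of \<open>det ?D\<close>, hence nonzero, which excludes zero eigenvalues.\<close>
  have \<mu>: "0 < \<mu> i" if "i < n" for i
  proof -
    have "det B = det K"
    proof -
      have "det (transpose_mat R) * det R = 1"
        using det_mult[of "transpose_mat R" n R] orth_matD(3)[OF R] by (simp add: det_one)
      moreover have "det B = det (transpose_mat R) * det K * det R"
        by (simp add: B_def det_mult[of _ n])
      ultimately show ?thesis by simp
    qed
    then have "det (M R) \<noteq> 0"
      using detK by (simp add: MB det_mult[of _ n])
    then have "\<mu> i \<noteq> 0"
      using that unfolding MU det_conj_mat_diag[OF U] by auto
    thus ?thesis using \<mu>0 that by force
  qed
  \<comment> \<open>The powers \<open>s - 1\<close> and \<open>s\<close> of \<open>M R\<close>,
    formed in one fixed eigenbasis rather than by the choice in \<open>psd_power\<close>.\<close>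
  let ?T = "U * mat_diag n (\<lambda>i. \<mu> i powr (s - 1)) * transpose_mat U"
  let ?P = "U * mat_diag n (\<lambda>i. \<mu> i powr s) * transpose_mat U"
  have diag_mult: "mat_diag n f * (mat_diag n g * X) = mat_diag n (\<lambda>i. f i * g i) * X"
    if "X \<in> carrier_mat n n" for f g :: "nat \<Rightarrow> real" and X
    using assoc_mult_mat[OF mat_diag_dim mat_diag_dim that] mat_diag_diag by metis
  have powr_mult_self: "x powr (s - 1) * x = x powr s" if "0 < x" for x :: real
    using powr_add[of x "s - 1" 1] that by simp
  have TM: "?T * M R = ?P"
  proof -
    have "?T * M R = U * mat_diag n (\<lambda>i. \<mu> i powr (s - 1) * \<mu> i) * transpose_mat U"
      unfolding MU by (simp add: diag_mult)
    also have "mat_diag n (\<lambda>i. \<mu> i powr (s - 1) * \<mu> i) = mat_diag n (\<lambda>i. \<mu> i powr s)"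
      using \<mu> powr_mult_self by (intro mat_diag_cong) auto
    finally show ?thesis .
  qed
  have MT: "M R * ?T = ?P"
  proof -
    have "M R * ?T = U * mat_diag n (\<lambda>i. \<mu> i * \<mu> i powr (s - 1)) * transpose_mat U"
      unfolding MU by (simp add: diag_mult)
    also have "mat_diag n (\<lambda>i. \<mu> i * \<mu> i powr (s - 1)) = mat_diag n (\<lambda>i. \<mu> i powr s)"
      using \<mu> powr_mult_self by (intro mat_diag_cong) (simp add: mult.commute)
    finally show ?thesis .
  qed
  have FR: "F R = (\<Sum>i<n. \<mu> i powr s)"
    unfolding F_def using \<mu>0 by (intro mtrace_psd_power[OF U _ MU]) auto
  \<comment> \<open>Cyclicity moves the outer factors \<open>?D\<close> onto \<open>?T\<close>, so
    the trace of \<open>?T * M Q\<close> becomes a linear functional of the conjugate of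
    \<open>K\<close> with coefficient \<open>C\<close>.\<close>
  define C where "C = ?D * ?T * ?D"
  have cC [simp]: "C \<in> carrier_mat n n" and symC: "transpose_mat C = C" by (simp_all add: C_def)
  have trC: "mtrace (C * (transpose_mat Q * K * Q)) = mtrace (?T * M Q)" if "orth_mat n Q" for Q
  proof -
    note [simp] = orth_matD(1,2)[OF that]
    have "C * (transpose_mat Q * K * Q) = ?D * (?T * (?D * (transpose_mat Q * K * Q)))" by (simp add: C_def)
    also have "mtrace \<dots> = mtrace (?T * (?D * (transpose_mat Q * K * Q)) * ?D)"
      by (rule mtrace_mult_commute[of _ n n]) auto
    also have "?T * (?D * (transpose_mat Q * K * Q)) * ?D = ?T * M Q" by (simp add: M_def)
    finally show ?thesis .
  qed
  have "C * B = B * C"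
    unfolding B_def
  proof (rule mtrace_conj_stationary[OF cC symC cK symK R])
    fix Q assume Q: "orth_mat n Q"
    obtain W \<nu> where W: "orth_mat n W" and \<nu>: "\<forall>i<n. 0 \<le> \<nu> i" and MQ: "M Q = W * mat_diag n \<nu> * transpose_mat W"
      using psdM[OF Q] unfolding psd_mat_def by blast
    have "F Q = (\<Sum>i<n. \<nu> i powr s)"
      unfolding F_def using \<nu> by (intro mtrace_psd_power[OF W _ MQ]) auto
    also have "\<dots> \<le> s * mtrace (?T * M Q) + (1 - s) * F R"
      unfolding MQ FR using \<nu> by (intro mtrace_powr_le_tangent U W s \<mu>) auto
    \<comment> \<open>Minimality of \<open>R\<close> for \<open>F\<close> meets the tangent bound at
      \<open>Q\<close>; as the bound is an equality at \<open>R\<close>, the concave problem reduces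
      to the linear one.\<close>
    finally have "F R \<le> s * mtrace (?T * M Q) + (1 - s) * F R"
      using min[OF Q] by simp
    moreover have "mtrace (?T * M R) = F R"
      unfolding TM FR by (rule mtrace_conj_mat_diag[OF U])
    ultimately have "s * mtrace (?T * M R) \<le> s * mtrace (?T * M Q)"
      by (simp add: algebra_simps del: assoc_mult_mat)
    thus "mtrace (C * (transpose_mat R * K * R)) \<le> mtrace (C * (transpose_mat Q * K * Q))"
      unfolding trC[OF Q] trC[OF R] using s(1) by simp
  qed
  \<comment> \<open>Multiplying by \<open>?D\<close> on both sides turns this into commutation of
    the square of \<open>?D\<close> with \<open>?P\<close>.\<close>
  then have "?D * (C * B) * ?D = ?D * (B * C) * ?D" by simp
  moreover have "?D * (C * B) * ?D = (?D * ?D) * (?T * M R)" by (simp add: C_def MB del: mat_diag_diag)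
  moreover have "?D * (B * C) * ?D = (M R * ?T) * (?D * ?D)" by (simp add: C_def MB del: mat_diag_diag)
  ultimately have "(?D * ?D) * ?P = ?P * (?D * ?D)" unfolding TM MT by simp
  moreover have "inj_on (\<lambda>i. d i * d i) {..<n}"
  proof (rule linorder_inj_onI)
    fix i j assume "i < j" "i \<in> {..<n}" "j \<in> {..<n}"
    then have "d i * d i < d j * d j" using d by (intro mult_strict_mono) (auto intro: less_imp_le)
    thus "d i * d i \<noteq> d j * d j" by simp
  qed auto
  ultimately obtain a where "?P = mat_diag n a"
    using commute_mat_diag_imp_diagonal[of ?P n "\<lambda>i. d i * d i"] by auto
  \<comment> \<open>Raising to the power \<open>1/s\<close> in the same eigenbasis recovers
    \<open>M R\<close> from \<open>?P\<close>, so it is diagonal too.\<close>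
  from conj_mat_diag_map[OF U this, of "\<lambda>x. x powr (1/s)"]
  have "U * mat_diag n (\<lambda>i. (\<mu> i powr s) powr (1/s)) * transpose_mat U = mat_diag n (\<lambda>i. a i powr (1/s))" .
  moreover have "mat_diag n (\<lambda>i. (\<mu> i powr s) powr (1/s)) = mat_diag n \<mu>"
    using \<mu>0 s by (intro mat_diag_cong) (auto simp: powr_powr)
  ultimately have Mdiag: "M R = mat_diag n (\<lambda>i. a i powr (1/s))" unfolding MU by simp
  have ent: "d i * B $$ (i,j) * d j = (if i = j then a i powr (1/s) else 0)" if "i < n" "j < n" for i j
  proof -
    have "(?D * B * ?D) $$ (i,j) = d i * B $$ (i,j) * d j"
      using that mat_diag_mult_left[OF cB, of d]
      by (subst mat_diag_mult_right[of _ n n]) (auto simp del: assoc_mult_mat)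
    thus ?thesis using that Mdiag unfolding MB by simp
  qed
  define b where "b i = B $$ (i,i)" for i
  have Bdiag: "B = mat_diag n b"
  proof (rule eq_matI)
    fix i j assume "i < dim_row (mat_diag n b)" "j < dim_col (mat_diag n b)"
    then have ij: "i < n" "j < n" by (auto simp: mat_diag_def)
    thus "B $$ (i,j) = mat_diag n b $$ (i,j)"
      using ent[OF ij] d(1)[OF ij(1)] d(1)[OF ij(2)] by (auto simp: b_def split: if_splits)
  qed (use carrier_matD[OF cB] in \<open>auto simp: mat_diag_def\<close>)
  have b0: "0 \<le> b i" if "i < n" for i
  proof -
    have "0 \<le> d i * b i * d i" using ent[OF that that] by (simp add: b_def)
    thus ?thesis using d(1)[OF that] by (simp add: zero_le_mult_iff)
  qed
  have Fdiag: "mtrace (psd_power (?D * mat_diag n c * ?D) s) = (\<Sum>i<n. (d i * c i * d i) powr s)"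
    if "\<And>i. i < n \<Longrightarrow> 0 \<le> c i" for c
  proof -
    have "?D * mat_diag n c * ?D = mat_diag n (\<lambda>i. d i * c i * d i)" by (simp only: mat_diag_diag)
    moreover have "psd_power (mat_diag n (\<lambda>i. d i * c i * d i)) s = mat_diag n (\<lambda>i. (d i * c i * d i) powr s)"
      using that d(1) by (intro psd_power_mat_diag) (simp add: less_imp_le)
    ultimately show ?thesis by (simp only: mtrace_mat_diag)
  qed
  \<comment> \<open>Separates weight from eigenvalue, so that the objective becomes a rearrangement
    sum.\<close>
  have split: "(d i * x * d i) powr s = (d i * d i) powr s * x powr s" if "0 \<le> x" "i < n" for x i
    using that d(1)[OF that(2)] powr_mult[of "d i * d i" x s] by (simp add: mult_ac)
  have bdesc: "b j \<le> b i" if ij: "i < j" "j < n" for i j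
  proof -
    have "i < n" using ij by simp
    obtain S where S: "orth_mat n S"
      "\<And>b :: nat \<Rightarrow> real. transpose_mat S * mat_diag n b * S = mat_diag n (\<lambda>x. b (Transposition.transpose i j x))"
      by (rule orth_mat_swap[of i n j]) (use ij in auto)
    note [simp] = orth_matD(1,2)[OF S(1)]
    have tr: "Transposition.transpose i j x < n" if "x < n" for x
      using that ij by (auto simp: Transposition.transpose_def)
    have "M (R * S) = ?D * (transpose_mat S * B * S) * ?D" by (simp add: M_def B_def)
    then have "F (R * S) = (\<Sum>x<n. (d x * b (Transposition.transpose i j x) * d x) powr s)"
      unfolding F_def Bdiag S(2) using b0 tr by (simp only: Fdiag)
    also have "\<dots> = (\<Sum>x<n. (d x * d x) powr s * (\<lambda>x. b x powr s) (Transposition.transpose i j x))"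
      using b0 tr by (intro sum.cong) (auto simp: split)
    finally have 1: "F (R * S) = \<dots>" .
    have "F R = (\<Sum>x<n. (d x * b x * d x) powr s)"
      unfolding F_def MB Bdiag using b0 by (simp only: Fdiag)
    also have "\<dots> = (\<Sum>x<n. (d x * d x) powr s * b x powr s)"
      using b0 by (intro sum.cong) (auto simp: split)
    finally have 2: "F R = \<dots>" .
    \<comment> \<open>Minimality against the swap \<open>R * S\<close>; since the weights strictly
      increase, the powers of \<open>b\<close> cannot increase.\<close>
    have "0 \<le> ((d j * d j) powr s - (d i * d i) powr s) * (b i powr s - b j powr s)"
      using min[OF orth_mat_mult[OF R S(1)]] ij
        sum_mult_transposition_diff[of i n j "\<lambda>x. (d x * d x) powr s" "\<lambda>x. b x powr s"] unfolding 1 2 by simp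
    moreover have "(d i * d i) powr s < (d j * d j) powr s"
      using d ij \<open>i < n\<close> s by (intro powr_less_mono2 mult_strict_mono) (auto intro: less_imp_le)
    ultimately have "b j powr s \<le> b i powr s" by (simp add: zero_le_mult_iff)
    thus ?thesis using powr_less_mono2[of s "b i" "b j"] b0[OF \<open>i < n\<close>] s by force
  qed
  have KR: "K = R * mat_diag n b * transpose_mat R"
    using Bdiag unfolding B_def by (intro conj_mat_diag_uncancel[OF R cK])
  \<comment> \<open>Both \<open>b\<close> and \<open>lam\<close> list the eigenvalues of
    \<open>K\<close> in decreasing order, so they coincide entry by entry.\<close>
  have "map b [0..<n] = rev (sorted_list_of_multiset (proots (char_poly K)))"
    using sorted_eigenvalues_conj_diag[of n R b] R bdesc unfolding KR[symmetric] by metis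
  moreover have "map lam [0..<n] = rev (sorted_list_of_multiset (proots (char_poly K)))"
    using sorted_eigenvalues_conj_diag[of n V lam] V lam(2) unfolding K[symmetric] by metis
  ultimately have "map b [0..<n] = map lam [0..<n]" by simp
  then have b_lam: "b i = lam i" if "i < n" for i
    using that by simp
  have "F R = (\<Sum>i<n. (d i * b i * d i) powr s)"
    unfolding F_def MB Bdiag using b0 by (simp only: Fdiag)
  also have "\<dots> = (\<Sum>i<n. (d i * lam i * d i) powr s)"
    by (intro sum.cong) (auto simp: b_lam)
  finally show ?thesis using min[OF Q] unfolding F_def M_def by simp
qed

text \<open>The strict case passes to the limit under a perturbation that keeps \<open>V\<close> and
  \<open>Q\<close> fixed.\<close>

lemma mtrace_psd_power_ge:
  assumes p: "0 < p" "p \<le> 1"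
    and v: "\<And>i. i < n \<Longrightarrow> 0 \<le> v i" "\<And>i j. i < j \<Longrightarrow> j < n \<Longrightarrow> v i \<le> v j"
    and V: "orth_mat n V" and lam: "\<And>i. i < n \<Longrightarrow> 0 \<le> lam i" "\<And>i j. i < j \<Longrightarrow> j < n \<Longrightarrow> lam j \<le> lam i"
    and K: "K = V * mat_diag n lam * transpose_mat V" and Q: "orth_mat n Q"
  defines "D \<equiv> mat_diag n (\<lambda>i. v i powr (1/p))"
  shows "(\<Sum>i<n. (v i powr (1/p) * lam i * v i powr (1/p)) powr (p/2)) \<le>
    mtrace (psd_power (D * transpose_mat Q * K * Q * D) (p/2))"
proof -
  define e where "e k = inverse (real (Suc k))" for k
  have e0: "0 < e k" for k by (simp add: e_def)
  have elim: "e \<longlonglongrightarrow> 0"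
    unfolding e_def by (rule LIMSEQ_inverse_real_of_nat)
  \<comment> \<open>The increment grows with \<open>i\<close>, so weakly increasing weights become
    strictly increasing; the factor \<open>Suc i\<close> also makes the entry at index 0
    positive.\<close>
  define dk where "dk k i = (v i + e k * real (Suc i)) powr (1/p)" for k i
  \<comment> \<open>A uniform shift makes all eigenvalues positive and preserves their
    order.\<close>
  define lk where "lk k i = lam i + e k" for k i
  define Kk where "Kk k = V * mat_diag n (lk k) * transpose_mat V" for k
  define Mk where "Mk k = mat_diag n (dk k) * transpose_mat Q * Kk k * Q * mat_diag n (dk k)" for k
  note [simp] = orth_matD(1,2)[OF V] orth_matD(1,2)[OF Q] assoc_mult_mat[of _ n n _ n _ n]
    mult_carrier_mat[of _ n n _ n] transpose_mult[of _ n n _ n]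
  have base: "0 < v i + e k * real (Suc i)" if "i < n" for i k
    using v(1)[OF that] e0[of k] by (intro add_nonneg_pos mult_pos_pos) auto
  have dlim: "(\<lambda>k. dk k i) \<longlonglongrightarrow> v i powr (1/p)" if "i < n" for i
  proof -
    have "(\<lambda>k. v i + e k * real (Suc i)) \<longlonglongrightarrow> v i + 0 * real (Suc i)"
      by (intro tendsto_intros elim)
    then have "(\<lambda>k. v i + e k * real (Suc i)) \<longlonglongrightarrow> v i" by simp
    thus ?thesis unfolding dk_def using p base[OF that]
      by (intro tendsto_powr' tendsto_const disjI2 conjI always_eventually allI) (auto intro: less_imp_le)
  qed
  have llim: "(\<lambda>k. lk k i) \<longlonglongrightarrow> lam i" for i
    using tendsto_add[OF tendsto_const elim, of "lam i"] by (simp add: lk_def)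
  have lk0: "0 < lk k i" if "i < n" for i k
    using lam(1)[OF that] e0[of k] by (simp add: lk_def)
  have psd: "psd_mat n (Mk k)" for k
  proof -
    have "psd_mat n (Kk k)" unfolding psd_mat_def Kk_def using V lk0 less_imp_le by blast
    from psd_mat_conj[OF this, of "Q * mat_diag n (dk k)"] show ?thesis
      by (simp add: Mk_def Kk_def)
  qed
  have lim: "mat_tendsto n Mk (D * transpose_mat Q * K * Q * D)"
    unfolding Mk_def Kk_def D_def K
    by (intro mat_tendsto_mult mat_tendsto_const mat_tendsto_diag dlim llim) auto
  \<comment> \<open>The right-hand side is controlled along a subsequence only; the left-hand side
    converges fully and is restricted to it below.\<close>
  obtain f where f: "strict_mono (f::nat \<Rightarrow> nat)"
    "(\<lambda>k. mtrace (psd_power (Mk (f k)) (p/2))) \<longlonglongrightarrow> mtrace (psd_power (D * transpose_mat Q * K * Q * D) (p/2))"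
    using mtrace_psd_power_convergent_subseq[OF psd lim, of "p/2"] p by auto
  have "(\<Sum>i<n. (dk k i * lk k i * dk k i) powr (p/2)) \<le> mtrace (psd_power (Mk k) (p/2))" for k
    unfolding Mk_def
  proof (rule mtrace_psd_power_ge_strict[OF _ _ _ _ V _ _ _ Q])
    show "0 < dk k i" if "i < n" for i using base[OF that, of k] by (simp add: dk_def)
    show "dk k i < dk k j" if "i < j" "j < n" for i j
    proof -
      have "e k * real (Suc i) < e k * real (Suc j)" using that e0[of k] by (intro mult_strict_left_mono) auto
      then have "v i + e k * real (Suc i) < v j + e k * real (Suc j)" using v(2)[OF that] by linarith
      thus ?thesis unfolding dk_def using p base[of i k] that by (intro powr_less_mono2) auto
    qed
    show "lk k j \<le> lk k i" if "i < j" "j < n" for i j using lam(2)[OF that] by (simp add: lk_def)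
  qed (use p lk0 Kk_def in auto)
  moreover have "0 \<le> dk k i * lk k i * dk k i" if "i < n" for i k
    using lk0[OF that, of k] by (simp add: dk_def)
  then have "(\<lambda>k. \<Sum>i<n. (dk k i * lk k i * dk k i) powr (p/2)) \<longlonglongrightarrow>
      (\<Sum>i<n. (v i powr (1/p) * lam i * v i powr (1/p)) powr (p/2))"
    using p by (intro tendsto_sum tendsto_powr' tendsto_mult dlim llim tendsto_const) auto
  from LIMSEQ_subseq_LIMSEQ[OF this f(1)]
  have "(\<lambda>k. \<Sum>i<n. (dk (f k) i * lk (f k) i * dk (f k) i) powr (p/2)) \<longlonglongrightarrow>
      (\<Sum>i<n. (v i powr (1/p) * lam i * v i powr (1/p)) powr (p/2))"
    by (simp add: o_def)
  ultimately show ?thesis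
    using LIMSEQ_le[OF _ f(2)] by blast
qed

text \<open>The minimum is expressed as an attained value together with a lower bound. It is
  attained at an eigenvector matrix \<open>V\<close> of the Gram matrix whose eigenvalues decrease,
  opposite to the weights.\<close>

theorem lemma4:
  fixes p :: real and m l n :: nat and \<phi> :: "real vec \<Rightarrow> real vec"
    and X :: "real mat" and w :: "nat \<Rightarrow> real"
  assumes p: "0 < p" "p \<le> 1"
    and \<phi>: "\<forall>x \<in> carrier_vec m. \<phi> x \<in> carrier_vec l"
    and X: "X \<in> carrier_mat m n"
    and w_nonneg: "\<forall>i \<in> {1..n}. 0 \<le> w i"
    and w_mono: "\<forall>i. 1 \<le> i \<and> i < n \<longrightarrow> w i \<le> w (Suc i)"
  shows "(\<exists>Q. orth_mat n Q \<and>
      mtrace (psd_power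
        (psd_power (mat_diag n (\<lambda>j. w (Suc j))) (1/p) * transpose_mat Q
          * (transpose_mat (feat_mat l \<phi> X) * feat_mat l \<phi> X)
          * Q * psd_power (mat_diag n (\<lambda>j. w (Suc j))) (1/p)) (p/2))
      = (\<Sum>i=1..n. w i * singular_value (feat_mat l \<phi> X) i powr p))
    \<and> (\<forall>Q. orth_mat n Q \<longrightarrow>
      (\<Sum>i=1..n. w i * singular_value (feat_mat l \<phi> X) i powr p)
      \<le> mtrace (psd_power
        (psd_power (mat_diag n (\<lambda>j. w (Suc j))) (1/p) * transpose_mat Q
          * (transpose_mat (feat_mat l \<phi> X) * feat_mat l \<phi> X)
          * Q * psd_power (mat_diag n (\<lambda>j. w (Suc j))) (1/p)) (p/2)))"
proof -
  let ?Y = "feat_mat l \<phi> X"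
  let ?K = "transpose_mat ?Y * ?Y"
  have Y: "?Y \<in> carrier_mat l n" using X by (auto simp: feat_mat_def)
  have K: "?K \<in> carrier_mat n n" "transpose_mat ?K = ?K"
    using Y by (simp_all add: transpose_mult[of _ n l _ n])
  obtain V lam where V: "orth_mat n V" and desc: "\<And>i j. i < j \<Longrightarrow> j < n \<Longrightarrow> lam j \<le> lam i"
    and KV: "?K = V * mat_diag n lam * transpose_mat V"
    using real_symmetric_diagonalization[OF K] by metis
  have lam0: "0 \<le> lam i" if "i < n" for i
    by (rule gram_diagonalization_nonneg[OF Y V KV that])
  have eigs: "gram_eigs_desc ?Y = map lam [0..<n]"
    unfolding gram_eigs_desc_def KV by (rule sorted_eigenvalues_conj_diag[OF V desc])
  \<comment> \<open>Matrix entries are indexed from 0, while \<open>w\<close> and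
    \<open>singular_value\<close> count from 1.\<close>
  define v where "v i = w (Suc i)" for i
  have v0: "0 \<le> v i" if "i < n" for i using w_nonneg that by (auto simp: v_def)
  have v_mono: "v i \<le> v j" if "i < j" "j < n" for i j
    using that
  proof (induction j)
    case (Suc j)
    have "v j \<le> v (Suc j)" using w_mono Suc.prems by (simp add: v_def)
    thus ?case using Suc by (cases "i = j") force+
  qed simp
  let ?D = "mat_diag n (\<lambda>i. v i powr (1/p))"
  have W: "psd_power (mat_diag n (\<lambda>j. w (Suc j))) (1/p) = ?D"
    using psd_power_mat_diag[of n v "1/p"] v0 unfolding v_def by blast
  have sv: "(\<Sum>i=1..n. w i * singular_value ?Y i powr p) =
      (\<Sum>i<n. (v i powr (1/p) * lam i * v i powr (1/p)) powr (p/2))"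
  proof -
    have "(\<Sum>i=1..n. w i * singular_value ?Y i powr p) = (\<Sum>i<n. v i * singular_value ?Y (Suc i) powr p)"
      by (simp add: sum.atLeast1_atMost_eq v_def)
    also have "\<dots> = (\<Sum>i<n. (v i powr (1/p) * lam i * v i powr (1/p)) powr (p/2))"
    proof (intro sum.cong refl)
      fix i assume "i \<in> {..<n}"
      then have i: "i < n" by simp
      \<comment> \<open>The singular value is the square root of \<open>lam i\<close>, which halves
        the exponent.\<close>
      have "singular_value ?Y (Suc i) powr p = lam i powr (p/2)"
        using i lam0[OF i] by (simp add: singular_value_def eigs powr_powr flip: powr_half_sqrt)
      moreover have "(v i powr (1/p) * lam i * v i powr (1/p)) powr (p/2) =
          ((v i powr (1/p)) powr (p/2) * (v i powr (1/p)) powr (p/2)) * lam i powr (p/2)"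
        using lam0[OF i] by (simp add: powr_mult mult_ac)
      \<comment> \<open>Each of the two outer factors contributes the square root of
        \<open>v i\<close>; this also covers \<open>v i = 0\<close>, where \<open>powr\<close> gives
        0.\<close>
      moreover have "(v i powr (1/p)) powr (p/2) * (v i powr (1/p)) powr (p/2) = v i"
        using p v0[OF i] by (simp add: powr_powr flip: powr_add)
      ultimately show "v i * singular_value ?Y (Suc i) powr p =
          (v i powr (1/p) * lam i * v i powr (1/p)) powr (p/2)" by simp
    qed
    finally show ?thesis .
  qed
  \<comment> \<open>Equality at \<open>Q = V\<close>: the conjugate of the Gram matrix is diagonal,
    so the power is taken entrywise.\<close>
  have "mtrace (psd_power (?D * transpose_mat V * ?K * V * ?D) (p/2)) =
      (\<Sum>i<n. (v i powr (1/p) * lam i * v i powr (1/p)) powr (p/2))"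
  proof -
    have "?D * transpose_mat V * ?K * V * ?D = ?D * (transpose_mat V * ?K * V) * ?D"
      using orth_matD(1,2)[OF V] K(1)
      by (simp add: assoc_mult_mat[of _ n n _ n _ n] mult_carrier_mat[of _ n n _ n])
    also have "\<dots> = mat_diag n (\<lambda>i. v i powr (1/p) * lam i * v i powr (1/p))"
      unfolding conj_mat_diag_cancel[OF V KV] by (simp only: mat_diag_diag)
    finally show ?thesis
      using lam0 by (simp add: psd_power_mat_diag mtrace_mat_diag)
  qed
  moreover have "(\<Sum>i<n. (v i powr (1/p) * lam i * v i powr (1/p)) powr (p/2)) \<le>
      mtrace (psd_power (?D * transpose_mat Q * ?K * Q * ?D) (p/2))" if "orth_mat n Q" for Q
    by (rule mtrace_psd_power_ge[OF p v0 v_mono V lam0 desc KV that])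
  ultimately show ?thesis unfolding W sv using V by blast
qed

end
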